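(* Let $\mathbb F$ be a field of characteristic zero and $n\geq 1$. For $k\geq 1$, the homogeneous component $Z_{n,k}$ is generated as a vector space by elements of the form $$\bigl(\cdots\bigl((y_0\circ_{d_1}y_0)\circ_{d_2}y_0\bigr)\cdots\bigr)\circ_{d_{k-1}}y_0,$$ where the number of factors $y_0$ is $k$ and the $d_i$ are chosen in such a way that $\circ_{d_i}$ is defined for each $i$. In particular, the ring $Z_n$ admits a minimal generating set (as an $\mathbb F$-algebra) formed by polynomials of this form.
   Context: Let $x$ be the $\mathbb F$-derivation $x(f)=\sum_{i=0}^{n-1}y_i\,\partial f/\partial y_{i+1}$ of $\mathbb F[y_0,\ldots,y_n]$, and let $Z_n=\{f\in\mathbb F[y_0,\ldots,y_n]\mid x(f)=0\}$; it is graded by degree, with degree-$k$ homogeneous component $Z_{n,k}$. ($Z_n$ is the center of the universal enveloping algebra of the standard filiform Lie algebra with basis $x,y_0,\ldots,y_n$ and nonzero brackets $[x,y_i]=y_{i-1}$, $1\leq i\leq n$.) Let $\hat f_n$ be the $\mathbb F$-derivation of $\mathbb F[y_0,\ldots,y_n]$ with $\hat f_n(y_i)=(i+1)(n-i)y_{i+1}$ for $0\leq i\leq n$ (so $\hat f_n(y_n)=0$), and $\hat h=[x,\hat f_n]$, the derivation with $\hat h(y_i)=(n-2i)y_i$. If $u_1,u_2\in Z_n$ are homogeneous $\hat h$-eigenvectors with eigenvalues $a_1,a_2$ and $0\leq d\leq\min\{a_1,a_2\}$, then $u_1\circ_du_2$ is defined as follows: put $u_{i,0}=u_i$ and $u_{i,k}=\frac{1}{k(a_i-k+1)}\hat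 f_n(u_{i,k-1})$ for $1\leq k\leq d$, $i\in\{1,2\}$, and $$u_1\circ_d u_2=\sum_{i=0}^d(-1)^iu_{1,i}u_{2,d-i}.$$ This is a homogeneous element of $Z_n$ which, if nonzero, is an $\hat h$-eigenvector with eigenvalue $a_1+a_2-2d$. The element $y_0$ has $\hat h$-eigenvalue $n$. *)

theory Defs
  imports Complex_Main "HOL-Library.Poly_Mapping"
begin

text \<open>
  Polynomials over a field in the variables \<open>y\<^sub>0, y\<^sub>1, \<dots>\<close>: finitely supported maps from exponent
  vectors to coefficients, multiplied by convolution. The ring in the variables
  \<open>y\<^sub>0, \<dots>, y\<^sub>n\<close> is the subset \<open>polys n\<close>.
\<close>

type_synonym 'a ypoly = "(nat \<Rightarrow>\<^sub>0 nat) \<Rightarrow>\<^sub>0 'a"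

definition Const :: "'a::zero \<Rightarrow> 'a ypoly" where
  "Const c = Poly_Mapping.single 0 c"

definition Y :: "nat \<Rightarrow> 'a::zero_neq_one ypoly" where
  "Y i = Poly_Mapping.single (Poly_Mapping.single i 1) 1"

definition scale :: "'a::comm_ring_1 \<Rightarrow> 'a ypoly \<Rightarrow> 'a ypoly" where
  "scale c p = Const c * p"

global_interpretation ypoly: vector_space "scale :: 'a::field \<Rightarrow> 'a ypoly \<Rightarrow> 'a ypoly"
  by unfold_locales
    (simp_all add: scale_def Const_def algebra_simps single_add mult_single
      flip: single_one mult.assoc)

definition polys :: "nat \<Rightarrow> 'a::zero ypoly set" where
  "polys n = {p. \<forall>m\<in>Poly_Mapping.keys p. Poly_Mapping.keys m \<subseteq> {..n}}"

definition homogeneous :: "nat \<Rightarrow> 'a::zero ypoly \<Rightarrow> bool" where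
  "homogeneous k p \<longleftrightarrow>
    (\<forall>m\<in>Poly_Mapping.keys p. (\<Sum>i\<in>Poly_Mapping.keys m. Poly_Mapping.lookup m i) = k)"

text \<open>
  If \<open>y\<^sub>i\<close> does not occur in the monomial \<open>m\<close>, the truncated difference
  \<open>m - Poly_Mapping.single i 1\<close> is harmless, since the coefficient is then \<open>0\<close>.
\<close>

definition partial_deriv :: "nat \<Rightarrow> 'a::comm_ring_1 ypoly \<Rightarrow> 'a ypoly" where
  "partial_deriv i p =
    (\<Sum>m\<in>Poly_Mapping.keys p.
      Poly_Mapping.single (m - Poly_Mapping.single i 1)
        (Poly_Mapping.lookup p m * of_nat (Poly_Mapping.lookup m i)))"

definition xder :: "nat \<Rightarrow> 'a::comm_ring_1 ypoly \<Rightarrow> 'a ypoly" where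
  "xder n p = (\<Sum>i<n. Y i * partial_deriv (Suc i) p)"

text \<open>The derivation of \<open>polys n\<close> with \<open>y\<^sub>i \<mapsto> (i + 1)(n - i) y\<^sub>i\<^sub>+\<^sub>1\<close>; the factor is \<open>0\<close> for \<open>i = n\<close>.\<close>

definition fhat :: "nat \<Rightarrow> 'a::comm_ring_1 ypoly \<Rightarrow> 'a ypoly" where
  "fhat n p = (\<Sum>i\<le>n. scale (of_nat ((i + 1) * (n - i))) (Y (i + 1)) * partial_deriv i p)"

definition hhat :: "nat \<Rightarrow> 'a::comm_ring_1 ypoly \<Rightarrow> 'a ypoly" where
  "hhat n p = xder n (fhat n p) - fhat n (xder n p)"

definition Z :: "nat \<Rightarrow> 'a::comm_ring_1 ypoly set" where
  "Z n = {p \<in> polys n. xder n p = 0}"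

definition Z_comp :: "nat \<Rightarrow> nat \<Rightarrow> 'a::comm_ring_1 ypoly set" where
  "Z_comp n k = {p \<in> Z n. homogeneous k p}"

text \<open>
  Every monomial is an eigenvector of \<open>hhat n\<close> with an integer eigenvalue, so in
  characteristic zero all eigenvalues on \<open>polys n\<close> come from unique integers.
\<close>

definition eigenvector :: "nat \<Rightarrow> int \<Rightarrow> 'a::comm_ring_1 ypoly \<Rightarrow> bool" where
  "eigenvector n a u \<longleftrightarrow> u \<noteq> 0 \<and> hhat n u = scale (of_int a) u"

definition eigenvalue :: "nat \<Rightarrow> 'a::comm_ring_1 ypoly \<Rightarrow> int" where
  "eigenvalue n u = (THE a. eigenvector n a u)"

text \<open>The elements \<open>u\<^sub>k\<close> obtained from \<open>u\<close> with eigenvalue \<open>a\<close>; only used for \<open>k \<le> a\<close>.\<close>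

primrec lift :: "nat \<Rightarrow> int \<Rightarrow> 'a::field ypoly \<Rightarrow> nat \<Rightarrow> 'a ypoly" where
  "lift n a u 0 = u"
| "lift n a u (Suc k) =
    scale (1 / (of_nat (Suc k) * of_int (a - int (Suc k) + 1))) (fhat n (lift n a u k))"

definition circ :: "nat \<Rightarrow> nat \<Rightarrow> 'a::field ypoly \<Rightarrow> 'a ypoly \<Rightarrow> 'a ypoly" where
  "circ n d u v =
    (\<Sum>i\<le>d. (-1) ^ i * lift n (eigenvalue n u) u i * lift n (eigenvalue n v) v (d - i))"

definition circ_arg :: "nat \<Rightarrow> 'a::comm_ring_1 ypoly \<Rightarrow> bool" where
  "circ_arg n u \<longleftrightarrow> u \<in> Z n \<and> (\<exists>k. homogeneous k u) \<and> (\<exists>a. eigenvector n a u)"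

definition circ_defined :: "nat \<Rightarrow> nat \<Rightarrow> 'a::field ypoly \<Rightarrow> 'a ypoly \<Rightarrow> bool" where
  "circ_defined n d u v \<longleftrightarrow>
    circ_arg n u \<and> circ_arg n v \<and> int d \<le> min (eigenvalue n u) (eigenvalue n v)"

text \<open>
  \<open>iterated n k u\<close>: \<open>u\<close> is a left-nested \<open>circ\<close>-product of \<open>k\<close> factors \<open>y\<^sub>0\<close>, each product being
  defined. Since eigenvectors are nonzero, every intermediate product is nonzero; the
  outermost one may vanish.
\<close>

inductive iterated :: "nat \<Rightarrow> nat \<Rightarrow> 'a::field ypoly \<Rightarrow> bool" for n where
  base: "iterated n 1 (Y 0)"
| step: "iterated n k u \<Longrightarrow> circ_defined n d u (Y 0) \<Longrightarrow> iterated n (Suc k) (circ n d u (Y 0))"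

definition subalgebra :: "'a::comm_ring_1 ypoly set \<Rightarrow> bool" where
  "subalgebra A \<longleftrightarrow> range Const \<subseteq> A \<and> (\<forall>p\<in>A. \<forall>q\<in>A. p + q \<in> A \<and> p * q \<in> A)"

definition generates :: "'a::comm_ring_1 ypoly set \<Rightarrow> 'a ypoly set \<Rightarrow> bool" where
  "generates S A \<longleftrightarrow> subalgebra hull S = A"

definition minimal_generating_set :: "'a::comm_ring_1 ypoly set \<Rightarrow> 'a ypoly set \<Rightarrow> bool" where
  "minimal_generating_set S A \<longleftrightarrow> generates S A \<and> (\<forall>T. T \<subset> S \<longrightarrow> \<not> generates T A)"

end

theory Submission
  imports Defs
begin

text \<open>
  The derivations \<open>xder\<close>, \<open>fhat\<close>, \<open>hhat\<close> form an \<open>sl\<^sub>2\<close>-triple acting locally finitely on polynomials.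
  If \<open>x(u) = 0\<close> and \<open>u\<close> has degree \<open>k + 1\<close>, put \<open>p = \<partial>u/\<partial>y\<^sub>0\<close>. From \<open>[\<partial>/\<partial>y\<^sub>i, x] = \<partial>/\<partial>y\<^sub>i\<^sub>+\<^sub>1\<close> one gets
  \<open>\<partial>u/\<partial>y\<^sub>i = (-1)\<^sup>i x\<^sup>i(p)\<close> and \<open>x\<^sup>n\<^sup>+\<^sup>1(p) = 0\<close>, so Euler's identity recovers \<open>u\<close> from \<open>p\<close> as
  \<open>(k + 1) u = contract p\<close>, where \<open>contract p\<close> is the sum of \<open>(-1)\<^sup>i x\<^sup>i(p) y\<^sub>i\<close> over \<open>i \<le> n\<close>.
  By \<open>sl\<^sub>2\<close>-theory \<open>p\<close> is a combination of \<open>fhat\<^sup>j(w)\<close> with \<open>j \<le> n\<close> and highest weight vectors \<open>w\<close> of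
  degree \<open>k\<close>, and \<open>contract (fhat\<^sup>j(w))\<close> is a multiple of \<open>w \<circ>\<^sub>j y\<^sub>0\<close>. Induction on \<open>k\<close> yields the
  spanning statement.

  For the minimal generating set, choose in each degree iterated products that form a basis of
  the homogeneous component modulo products of elements of lower positive degree.
\<close>

section \<open>Locally finite representations of \<open>sl\<^sub>2\<close>\<close>

text \<open>Local nilpotency, with an exponent depending on the vector, takes the place of finite
  dimension. The invariant subspace \<open>V\<close> will be one homogeneous component: it keeps the
  generators of all strings in a single polynomial degree.\<close>

locale sl2_module = vector_space s for s :: "'a::field_char_0 \<Rightarrow> 'b::ab_group_add \<Rightarrow> 'b" +
  fixes X F H :: "'b \<Rightarrow> 'b" and V :: "'b set"
  assumes X_add: "X (p + q) = X p + X q" and X_scale: "X (s c p) = s c (X p)"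
    and F_add: "F (p + q) = F p + F q" and F_scale: "F (s c p) = s c (F p)"
    and H_eq: "H p = X (F p) - F (X p)"
    and H_X: "H (X p) = X (H p) + s 2 (X p)"
    and H_F: "H (F p) = F (H p) - s 2 (F p)"
    and subspace_V: "subspace V"
    and X_V: "p \<in> V \<Longrightarrow> X p \<in> V" and F_V: "p \<in> V \<Longrightarrow> F p \<in> V"
    and X_nilpotent: "\<exists>N. (X ^^ N) p = 0" and F_nilpotent: "\<exists>N. (F ^^ N) p = 0"
begin

section \<open>Weights and powers of the operators\<close>

definition weight :: "int \<Rightarrow> 'b \<Rightarrow> bool" where
  "weight a p \<longleftrightarrow> H p = s (of_int a) p"

text \<open>The index \<open>b\<close> is the weight of the listed vector \<open>(F ^^ j) v\<close>,
  not of its generator: \<open>F\<close> lowers weights by 2, so \<open>v\<close> must have weight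
  \<open>b + 2 * j\<close>.\<close>

definition strings :: "int \<Rightarrow> nat \<Rightarrow> 'b set" where
  "strings b D = {(F ^^ j) v | j v. j < D \<and> v \<in> V \<and> X v = 0 \<and> weight (b + 2 * int j) v}"

lemma X_0: "X 0 = 0"
  using X_add[of 0 0] by simp

lemma F_0: "F 0 = 0"
  using F_add[of 0 0] by simp

lemma X_minus: "X (- p) = - X p"
  using X_add[of p "- p"] by (simp add: X_0 eq_neg_iff_add_eq_0 add.commute)

lemma F_minus: "F (- p) = - F p"
  using F_add[of p "- p"] by (simp add: F_0 eq_neg_iff_add_eq_0 add.commute)

lemma Xpow_0: "(X ^^ i) 0 = 0"
  by (induction i) (auto simp: X_0)

lemma Xpow_add: "(X ^^ i) (p + q) = (X ^^ i) p + (X ^^ i) q"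
  by (induction i) (auto simp: X_add)

lemma Xpow_scale: "(X ^^ i) (s c p) = s c ((X ^^ i) p)"
  by (induction i) (auto simp: X_scale)

lemma Xpow_minus: "(X ^^ i) (- p) = - (X ^^ i) p"
  by (induction i) (auto simp: X_minus)

lemma Xpow_diff: "(X ^^ i) (p - q) = (X ^^ i) p - (X ^^ i) q"
  using Xpow_add[of i p "- q"] by (simp add: Xpow_minus)

text \<open>The Chevalley-type symmetry of sl2. It makes every result on highest weight vectors
  available for lowest weight vectors.\<close>

lemma mirror: "sl2_module s F X (\<lambda>p. - H p) V"
proof unfold_locales
  show "- H (F p) = F (- H p) + s 2 (F p)" for p
    by (simp add: H_F F_minus)
  show "- H (X p) = X (- H p) - s 2 (X p)" for p
    by (simp add: H_X X_minus)
qed (auto simp: X_add X_scale F_add F_scale H_eq subspace_V X_V F_V X_nilpotent F_nilpotent)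

lemma Xpow_V: "p \<in> V \<Longrightarrow> (X ^^ i) p \<in> V"
  by (induction i) (auto simp: X_V)

lemma Fpow_V: "p \<in> V \<Longrightarrow> (F ^^ i) p \<in> V"
  by (induction i) (auto simp: F_V)

lemma H_add: "H (p + q) = H p + H q"
  by (simp add: H_eq X_add F_add)

lemma H_scale: "H (s c p) = s c (H p)"
  by (simp add: H_eq X_scale F_scale scale_right_diff_distrib)

lemma H_0: "H 0 = 0"
  by (simp add: H_eq X_0 F_0)

lemma weight_0: "weight a 0"
  by (simp add: weight_def H_0)

lemma weight_add: "weight a p \<Longrightarrow> weight a q \<Longrightarrow> weight a (p + q)"
  by (simp add: weight_def H_add scale_right_distrib)

lemma weight_scale: "weight a p \<Longrightarrow> weight a (s c p)"
  by (simp add: weight_def H_scale mult.commute)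

lemma weight_diff: "weight a p \<Longrightarrow> weight a q \<Longrightarrow> weight a (p - q)"
  using weight_add[of a p "s (-1) q"] weight_scale[of a q "-1"] by simp

lemma weight_X: "weight a p \<Longrightarrow> weight (a + 2) (X p)"
  by (simp add: weight_def H_X X_scale scale_left_distrib)

lemma weight_F: "weight a p \<Longrightarrow> weight (a - 2) (F p)"
  by (simp add: weight_def H_F F_scale scale_left_diff_distrib)

lemma weight_Xpow: "weight a p \<Longrightarrow> weight (a + 2 * int i) ((X ^^ i) p)"
proof (induction i)
  case (Suc i)
  then show ?case using weight_X[of "a + 2 * int i" "(X ^^ i) p"] by (simp add: algebra_simps)
qed simp

lemma weight_Fpow: "weight a p \<Longrightarrow> weight (a - 2 * int i) ((F ^^ i) p)"
proof (induction i)
  case (Suc i)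
  then show ?case using weight_F[of "a - 2 * int i" "(F ^^ i) p"] by (simp add: algebra_simps)
qed simp

text \<open>Moving \<open>X\<close> past one \<open>F\<close> costs one \<open>H\<close>, which acts
  on \<open>(F ^^ i) v\<close> by \<open>a - 2 * i\<close>. Summing these values over i \<le> k
  gives \<open>(k + 1) * (a - k)\<close>.\<close>

lemma X_Fpow_Suc:
  assumes "X v = 0" "weight a v"
  shows "X ((F ^^ Suc k) v) = s (of_nat (Suc k) * of_int (a - int k)) ((F ^^ k) v)"
proof (induction k)
  case 0
  then show ?case using assms H_eq[of v] by (simp add: weight_def F_0)
next
  case (Suc k)
  let ?w = "(F ^^ Suc k) v"
  have "X (F ?w) = F (X ?w) + H ?w"
    by (simp add: H_eq)
  also have "F (X ?w) = s (of_nat (Suc k) * of_int (a - int k)) ?w"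
    by (simp only: Suc.IH F_scale) simp
  also have "H ?w = s (of_int (a - 2 * int (Suc k))) ?w"
    using weight_Fpow[OF assms(2), of "Suc k"] by (simp only: weight_def)
  also have "s (of_nat (Suc k) * of_int (a - int k)) ?w + s (of_int (a - 2 * int (Suc k))) ?w
      = s (of_nat (Suc (Suc k)) * of_int (a - int (Suc k))) ?w"
    unfolding scale_left_distrib[symmetric]
    by (rule arg_cong[where f = "\<lambda>c. s c ?w"]) (simp add: algebra_simps)
  finally show ?case by simp
qed

lemma Xpow_Fpow:
  assumes "X v = 0" "weight a v"
  shows "(X ^^ i) ((F ^^ (i + j)) v)
    = s (\<Prod>k<i. of_nat (Suc (j + k)) * of_int (a - int (j + k))) ((F ^^ j) v)"
proof (induction i)
  case (Suc i)
  have "(X ^^ Suc i) ((F ^^ (Suc i + j)) v) = (X ^^ i) (X ((F ^^ Suc (i + j)) v))"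
    by (simp only: funpow_Suc_right o_apply add_Suc)
  also have "\<dots> = s (of_nat (Suc (i + j)) * of_int (a - int (i + j))) ((X ^^ i) ((F ^^ (i + j)) v))"
    by (simp only: X_Fpow_Suc[OF assms] Xpow_scale)
  finally show ?case
    by (simp add: Suc.IH mult.commute add.commute)
qed simp

text \<open>In characteristic zero the coefficient vanishes only if \<open>a\<close> equals some
  \<open>j + k\<close> with \<open>k < i\<close>; the two alternatives in the hypothesis put
  \<open>a\<close> below or above that range.\<close>

lemma Xpow_Fpow_nonzero:
  assumes "X v = 0" "weight a v" "a < int j \<or> int (i + j) \<le> a"
  obtains c where "c \<noteq> 0" "(X ^^ i) ((F ^^ (i + j)) v) = s c ((F ^^ j) v)"
proof
  show "(\<Prod>k<i. of_nat (Suc (j + k)) * of_int (a - int (j + k)) :: 'a) \<noteq> 0"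
    using assms(3) by (auto simp del: of_nat_Suc of_int_diff)
qed (rule Xpow_Fpow[OF assms(1,2)])

text \<open>For negative \<open>a\<close> none of the coefficients vanishes, so all powers of
  \<open>X\<close> lead from \<open>(F ^^ N) v\<close> back to a nonzero multiple of
  \<open>v\<close>, contradicting the nilpotency of \<open>F\<close> on \<open>v\<close>.\<close>

lemma highest_weight_nonneg:
  assumes "X v = 0" "weight a v" "v \<noteq> 0"
  shows "0 \<le> a"
proof (rule ccontr)
  assume "\<not> 0 \<le> a"
  obtain N where N: "(F ^^ N) v = 0" using F_nilpotent by blast
  obtain c where "c \<noteq> 0" "(X ^^ N) ((F ^^ (N + 0)) v) = s c ((F ^^ 0) v)"
    using Xpow_Fpow_nonzero[OF assms(1,2), of 0 N] \<open>\<not> 0 \<le> a\<close> by auto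
  with N assms(3) show False by (simp add: Xpow_0)
qed

text \<open>At \<open>k = a\<close> the factor \<open>a - k\<close> is zero, so
  \<open>(F ^^ (a + 1)) v\<close> is again annihilated by \<open>X\<close>. Its weight
  \<open>- a - 2\<close> is negative, hence it vanishes, and so do all later powers.\<close>

lemma Fpow_highest_weight_eq_0:
  assumes "X v = 0" "weight a v" "a < int j"
  shows "(F ^^ j) v = 0"
proof (cases "v = 0")
  case True
  then show ?thesis by (induction j) (auto simp: F_0)
next
  case False
  then have a: "0 \<le> a" using highest_weight_nonneg assms by blast
  let ?k = "nat a"
  have "X ((F ^^ Suc ?k) v) = 0"
    using X_Fpow_Suc[OF assms(1,2), of ?k] a by simp
  moreover have "weight (a - 2 * int (Suc ?k)) ((F ^^ Suc ?k) v)"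
    using weight_Fpow[OF assms(2)] .
  ultimately have "(F ^^ Suc ?k) v = 0"
    using highest_weight_nonneg a by fastforce
  moreover have "(F ^^ i) 0 = 0" for i
    by (induction i) (auto simp: F_0)
  moreover have "j = (j - Suc ?k) + Suc ?k" using assms(3) a by linarith
  ultimately show ?thesis by (metis funpow_add o_apply)
qed

section \<open>Decomposition of weight vectors into strings\<close>

lemma strings_mono: "D \<le> E \<Longrightarrow> strings b D \<subseteq> strings b E"
  unfolding strings_def using order_less_le_trans by blast

lemma in_strings:
  "j < D \<Longrightarrow> v \<in> V \<Longrightarrow> X v = 0 \<Longrightarrow> weight (b + 2 * int j) v \<Longrightarrow> (F ^^ j) v \<in> strings b D"
  unfolding strings_def by blast

text \<open>Peel off the longest string: \<open>w = (X ^^ D) p\<close> is a highest weight vector,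
  and since \<open>b\<close> is nonnegative, \<open>(X ^^ D) ((F ^^ D) w)\<close> is a nonzero
  multiple of \<open>w\<close>. Subtracting the right multiple of \<open>(F ^^ D) w\<close> from
  \<open>p\<close> leaves a vector killed by \<open>X ^^ D\<close>.\<close>

lemma in_span_strings_nonneg:
  assumes "0 \<le> b" "p \<in> V" "weight b p" "(X ^^ D) p = 0"
  shows "p \<in> span (strings b D)"
  using assms(2-)
proof (induction D arbitrary: p)
  case 0
  then show ?case by (simp add: span_zero)
next
  case (Suc D)
  define w where "w = (X ^^ D) p"
  have w: "w \<in> V" "X w = 0" "weight (b + 2 * int D) w"
    using Suc.prems by (auto simp: w_def Xpow_V weight_Xpow)
  obtain c where c: "c \<noteq> 0" "(X ^^ D) ((F ^^ (D + 0)) w) = s c ((F ^^ 0) w)"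
    by (rule Xpow_Fpow_nonzero[OF w(2,3), of 0 D]) (use assms(1) in auto)
  define q where "q = s (1 / c) ((F ^^ D) w)"
  have q: "(F ^^ D) w \<in> strings b (Suc D)"
    by (rule in_strings) (use w in auto)
  have "weight b ((F ^^ D) w)"
    using weight_Fpow[OF w(3), of D] by simp
  then have "p - q \<in> span (strings b D)"
    using Suc.prems w c unfolding q_def
    by (intro Suc.IH)
      (auto simp: Xpow_diff Xpow_scale w_def intro!: subspace_diff[OF subspace_V]
        subspace_scale[OF subspace_V] Fpow_V Xpow_V weight_diff weight_scale)
  then have "p - q \<in> span (strings b (Suc D))"
    using span_mono[OF strings_mono[of D "Suc D" b]] by auto
  moreover have "q \<in> span (strings b (Suc D))"
    unfolding q_def using q by (intro span_scale span_base)
  ultimately show ?case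
    using span_add by fastforce
qed

text \<open>
  In negative weights, decompose into strings going up from lowest weight vectors and read each
  of these strings backwards.
\<close>

lemma in_span_strings:
  assumes "p \<in> V" "weight b p"
  obtains D where "p \<in> span (strings b D)"
proof (cases "0 \<le> b")
  case True
  obtain D where "(X ^^ D) p = 0" using X_nilpotent by blast
  with True assms in_span_strings_nonneg that show ?thesis by blast
next
  case False
  interpret mirror: sl2_module s F X "\<lambda>p. - H p" V by (rule mirror)
  have mw: "mirror.weight a q \<longleftrightarrow> weight (- a) q" for a q
    by (simp add: mirror.weight_def weight_def neg_eq_iff_add_eq_0 eq_neg_iff_add_eq_0)
  define m where "m = nat (- b)"
  obtain D where "(F ^^ D) p = 0" using F_nilpotent by blast
  then have "p \<in> span (mirror.strings (- b) D)"
    using False assms by (intro mirror.in_span_strings_nonneg) (auto simp: mw)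
  moreover
  have "mirror.strings (- b) D \<subseteq> span (strings b (m + D))"
  proof
    fix q assume "q \<in> mirror.strings (- b) D"
    then obtain j v where j: "q = (X ^^ j) v" "j < D" "v \<in> V" "F v = 0"
        "mirror.weight (- b + 2 * int j) v"
      unfolding mirror.strings_def by blast
    \<comment> \<open>The lowest weight vector \<open>v\<close> has weight
      \<open>b - 2 * j = - (m + 2 * j)\<close>, so \<open>w\<close> is the other end of its string.
      Going down \<open>m + j\<close> steps from \<open>w\<close> returns to a nonzero multiple of
      \<open>q\<close>.\<close>
    define w where "w = (X ^^ (m + j + j)) v"
    obtain c where c: "c \<noteq> 0" "(F ^^ (m + j)) w = s c q"
      using mirror.Xpow_Fpow_nonzero[OF j(4,5), of j "m + j"] False unfolding j(1) w_def m_def by auto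
    have "X w = (X ^^ Suc (m + j + j)) v" by (simp add: w_def)
    also have "\<dots> = 0"
      by (rule mirror.Fpow_highest_weight_eq_0[OF j(4,5)]) (use False in \<open>auto simp: m_def\<close>)
    finally have "X w = 0" .
    moreover have "weight (b + 2 * int (m + j)) w"
      using weight_Xpow[of "b - 2 * int j" v "m + j + j"] j(5) False
      by (simp add: mw w_def m_def algebra_simps)
    ultimately have "(F ^^ (m + j)) w \<in> strings b (m + D)"
      using j by (intro in_strings) (auto simp: w_def Xpow_V)
    then have "s (1 / c) ((F ^^ (m + j)) w) \<in> span (strings b (m + D))"
      by (intro span_scale span_base)
    then show "q \<in> span (strings b (m + D))" using c by simp
  qed
  then have "span (mirror.strings (- b) D) \<subseteq> span (strings b (m + D))"
    by (rule span_minimal) (rule subspace_span)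
  ultimately show ?thesis
    by (intro that[of "m + D"]) (rule rev_subsetD)
qed

text \<open>The generators of the strings with exponent exactly \<open>D\<close> form a subspace, so
  a combination of such strings is \<open>F ^^ D\<close> of one single generator.\<close>

lemma span_strings_Suc:
  assumes "p \<in> span (strings b (Suc D))"
  obtains v where "v \<in> V" "X v = 0" "weight (b + 2 * int D) v"
    "p - (F ^^ D) v \<in> span (strings b D)"
proof -
  define T where "T = {v \<in> V. X v = 0 \<and> weight (b + 2 * int D) v}"
  interpret F: module_hom s s "F ^^ D"
  proof
    show "(F ^^ D) (p + q) = (F ^^ D) p + (F ^^ D) q" for p q
      by (induction D) (auto simp: F_add)
    show "(F ^^ D) (s c p) = s c ((F ^^ D) p)" for c p
      by (induction D) (auto simp: F_scale)
  qed
  have T: "subspace T"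
    unfolding T_def using subspace_V
    by (auto simp: subspace_def X_add X_scale X_0 weight_0 weight_add weight_scale)
  have "strings b (Suc D) \<subseteq> strings b D \<union> (F ^^ D) ` T"
    unfolding strings_def T_def by (auto simp: less_Suc_eq)
  then have "p \<in> span (strings b D \<union> (F ^^ D) ` T)"
    using assms span_mono by blast
  then obtain x y where xy: "p = x + y" "x \<in> span (strings b D)" "y \<in> span ((F ^^ D) ` T)"
    unfolding span_Un by blast
  have "span ((F ^^ D) ` T) = (F ^^ D) ` T"
    using F.subspace_image[OF T] by (simp only: span_eq_iff)
  with xy(3) obtain v where v: "v \<in> T" "y = (F ^^ D) v"
    by blast
  show ?thesis
    by (rule that[of v]) (use v xy in \<open>auto simp: T_def\<close>)
qed

text \<open>On a string element \<open>(F ^^ j) v\<close>, the power \<open>X ^^ j\<close> leads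
  back to a multiple of \<open>v\<close>, and one more \<open>X\<close> kills it.\<close>

lemma Xpow_strings_eq_0:
  assumes "p \<in> span (strings b D)"
  shows "(X ^^ D) p = 0"
proof -
  have "subspace {p. (X ^^ D) p = 0}"
    by (auto simp: subspace_def Xpow_0 Xpow_add Xpow_scale)
  moreover have "strings b D \<subseteq> {p. (X ^^ D) p = 0}"
  proof
    fix q assume "q \<in> strings b D"
    then obtain j v where j: "q = (F ^^ j) v" "j < D" "X v = 0" "weight (b + 2 * int j) v"
      unfolding strings_def by blast
    have "(X ^^ Suc j) q = X ((X ^^ j) ((F ^^ (j + 0)) v))"
      using j by simp
    then have "(X ^^ Suc j) q = 0"
      unfolding Xpow_Fpow[OF j(3,4)] by (simp add: X_scale j)
    moreover have "D = (D - Suc j) + Suc j" using j by simp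
    then have "(X ^^ D) q = (X ^^ (D - Suc j)) ((X ^^ Suc j) q)"
      by (metis funpow_add o_apply)
    ultimately show "q \<in> {p. (X ^^ D) p = 0}"
      by (simp add: Xpow_0 del: funpow.simps)
  qed
  ultimately show ?thesis using span_minimal assms by blast
qed

text \<open>This bounds the exponents by \<open>d\<close> in negative weights too. Starting from any
  bound, remove the top term \<open>(F ^^ D) v\<close>: since \<open>X ^^ D\<close> kills
  \<open>p\<close> and all shorter strings, it kills this term. Either \<open>D\<close> exceeds the
  weight of \<open>v\<close>, and the term is zero anyway, or \<open>X ^^ D\<close> maps it to a
  nonzero multiple of \<open>v\<close>, and \<open>v = 0\<close>.\<close>

lemma in_span_strings_if_Xpow_eq_0:
  assumes "p \<in> V" "weight b p" "(X ^^ d) p = 0"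
  shows "p \<in> span (strings b d)"
proof -
  have "p \<in> span (strings b D) \<Longrightarrow> d \<le> D \<Longrightarrow> p \<in> span (strings b d)" for D
  proof (induction D)
    case (Suc D)
    show ?case
    proof (cases "d = Suc D")
      case False
      then have "d \<le> D" using Suc.prems by simp
      obtain v where v: "v \<in> V" "X v = 0" "weight (b + 2 * int D) v"
        "p - (F ^^ D) v \<in> span (strings b D)"
        using Suc.prems(1) by (rule span_strings_Suc)
      have "(X ^^ D) p = (X ^^ (D - d)) ((X ^^ d) p)"
        using \<open>d \<le> D\<close> by (metis funpow_add o_apply le_add_diff_inverse2)
      then have "(X ^^ D) p = 0" by (simp add: assms(3) Xpow_0)
      then have 0: "(X ^^ D) ((F ^^ D) v) = 0"
        using Xpow_strings_eq_0[OF v(4)] by (simp add: Xpow_diff)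
      have "(F ^^ D) v = 0"
      proof (cases "b + 2 * int D < int D")
        case True
        then show ?thesis using Fpow_highest_weight_eq_0[OF v(2,3)] by blast
      next
        case False
        obtain c where "c \<noteq> 0" "(X ^^ D) ((F ^^ (D + 0)) v) = s c ((F ^^ 0) v)"
          by (rule Xpow_Fpow_nonzero[OF v(2,3), of 0 D]) (use False in auto)
        with 0 have "v = 0" by simp
        then show ?thesis by (induction D) (auto simp: F_0)
      qed
      with v(4) Suc.IH \<open>d \<le> D\<close> show ?thesis by simp
    qed (use Suc.prems in auto)
  qed simp
  moreover obtain D where "p \<in> span (strings b D)"
    using in_span_strings assms(1,2) .
  \<comment> \<open>The descent must start at a bound not below \<open>d\<close>.\<close>
  moreover have "p \<in> span (strings b (max d D))"
    using \<open>p \<in> span (strings b D)\<close> span_mono[OF strings_mono[of D "max d D" b]] by auto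
  ultimately show ?thesis by (meson max.cobounded1)
qed

text \<open>Applying \<open>H - b\<close> removes the component of weight \<open>b\<close> and
  multiplies every other one by the nonzero number \<open>a - b\<close>, so induction on the number
  of weights applies.\<close>

lemma weight_sum_eq_0:
  assumes "finite A" "\<And>a. a \<in> A \<Longrightarrow> weight a (v a)" "(\<Sum>a\<in>A. v a) = 0" "a \<in> A"
  shows "v a = 0"
  using assms
proof (induction A arbitrary: v a rule: finite_induct)
  case (insert b A)
  define w where "w a = s (of_int (a - b)) (v a)" for a
  have H_sum: "H (\<Sum>a\<in>B. v a) = (\<Sum>a\<in>B. H (v a))" for B
    by (induction B rule: infinite_finite_induct) (auto simp: H_add H_0)
  have "(\<Sum>a\<in>insert b A. w a) = H (\<Sum>a\<in>insert b A. v a) - s (of_int b) (\<Sum>a\<in>insert b A. v a)"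
    using insert.prems(1) unfolding H_sum scale_sum_right sum_subtractf[symmetric] w_def
    by (intro sum.cong) (auto simp: weight_def scale_left_diff_distrib)
  also have "\<dots> = 0" by (simp add: insert.prems H_0)
  finally have "(\<Sum>a\<in>A. w a) = 0"
    using insert.hyps by (simp add: w_def)
  moreover have "weight a (w a)" if "a \<in> A" for a
    unfolding w_def using that insert.prems(1) by (intro weight_scale) simp
  ultimately have "w a = 0" if "a \<in> A" for a
    using that by (intro insert.IH[of w])
  then have A: "v a = 0" if "a \<in> A" for a
    using that insert.hyps(2) by (auto simp: w_def simp del: of_int_diff)
  then have "v b = 0" using insert by simp
  with A insert.prems show ?case by blast
qed simp

lemma in_span_Fpow_if_Xpow_eq_0:
  assumes "finite B" "\<And>b. b \<in> B \<Longrightarrow> v b \<in> V \<and> weight b (v b)" "(X ^^ d) (\<Sum>b\<in>B. v b) = 0"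
  shows "(\<Sum>b\<in>B. v b) \<in> span {(F ^^ j) w | j w. j < d \<and> w \<in> V \<and> X w = 0}"
proof (rule span_sum)
  fix b assume b: "b \<in> B"
  have Xpow_sum: "(X ^^ d) (\<Sum>b\<in>A. v b) = (\<Sum>b\<in>A. (X ^^ d) (v b))" for A
    by (induction A rule: infinite_finite_induct) (auto simp: Xpow_add Xpow_0)
  \<comment> \<open>The images under \<open>X ^^ d\<close>, reindexed by their own weights, which
    are shifted by \<open>2 * d\<close>. Distinct weights stay distinct, so \<open>X ^^ d\<close>
    kills each component separately.\<close>
  define g where "g a = (X ^^ d) (v (a - 2 * int d))" for a
  have "(\<Sum>a\<in>(\<lambda>b. b + 2 * int d) ` B. g a) = (\<Sum>b\<in>B. (X ^^ d) (v b))"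
    by (subst sum.reindex) (auto simp: inj_on_def g_def)
  then have "(\<Sum>a\<in>(\<lambda>b. b + 2 * int d) ` B. g a) = 0"
    using assms(3) Xpow_sum by simp
  then have "g (b + 2 * int d) = 0"
    using assms(1,2) b weight_Xpow[of _ "v _" d]
    by (intro weight_sum_eq_0[of "(\<lambda>b. b + 2 * int d) ` B" g]) (auto simp: g_def)
  then have "(X ^^ d) (v b) = 0" by (simp add: g_def)
  then have "v b \<in> span (strings b d)"
    using assms(2)[OF b] in_span_strings_if_Xpow_eq_0 by blast
  moreover have "strings b d \<subseteq> {(F ^^ j) w | j w. j < d \<and> w \<in> V \<and> X w = 0}"
    unfolding strings_def by blast
  ultimately show "v b \<in> span {(F ^^ j) w | j w. j < d \<and> w \<in> V \<and> X w = 0}"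
    using span_mono by blast
qed

end

section \<open>Derivations of the polynomial ring\<close>

definition deg :: "(nat \<Rightarrow>\<^sub>0 nat) \<Rightarrow> nat" where
  "deg m = (\<Sum>i\<in>Poly_Mapping.keys m. Poly_Mapping.lookup m i)"

definition Vhom :: "nat \<Rightarrow> nat \<Rightarrow> 'a::zero ypoly set" where
  "Vhom n k = {p \<in> polys n. homogeneous k p}"

lemma deg_superset:
  assumes "finite A" "Poly_Mapping.keys m \<subseteq> A"
  shows "(\<Sum>i\<in>A. Poly_Mapping.lookup m i) = deg m"
  unfolding deg_def by (rule sum.mono_neutral_right) (use assms in \<open>auto simp: in_keys_iff\<close>)

lemma keys_add_nat: "Poly_Mapping.keys (m + m' :: nat \<Rightarrow>\<^sub>0 nat) = Poly_Mapping.keys m \<union> Poly_Mapping.keys m'"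
  by (auto simp: in_keys_iff lookup_add)

lemma deg_add: "deg (m + m') = deg m + deg m'"
proof -
  let ?A = "Poly_Mapping.keys m \<union> Poly_Mapping.keys m'"
  have "deg (m + m') = (\<Sum>i\<in>?A. Poly_Mapping.lookup (m + m') i)"
    by (rule deg_superset[symmetric]) (auto simp: keys_add_nat)
  also have "\<dots> = deg m + deg m'"
    by (simp add: lookup_add sum.distrib deg_superset)
  finally show ?thesis .
qed

lemma deg_0 [simp]: "deg 0 = 0"
  by (simp add: deg_def)

lemma deg_single [simp]: "deg (Poly_Mapping.single i c) = c"
  by (simp add: deg_def)

lemma deg_eq_0_iff: "deg m = 0 \<longleftrightarrow> m = 0"
proof
  assume "deg m = 0"
  then show "m = 0"
    by (auto simp: deg_def in_keys_iff intro!: poly_mapping_eqI)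
qed simp

lemma add_single_minus:
  fixes m :: "nat \<Rightarrow>\<^sub>0 nat"
  assumes "Poly_Mapping.lookup m i \<noteq> 0"
  shows "m = (m - Poly_Mapping.single i 1) + Poly_Mapping.single i 1"
  by (rule poly_mapping_eqI)
    (use assms in \<open>auto simp: lookup_add lookup_minus lookup_single when_def\<close>)

lemma exponent_induct [case_names zero add]:
  fixes m :: "nat \<Rightarrow>\<^sub>0 nat"
  assumes "P 0" "\<And>m i. P m \<Longrightarrow> P (m + Poly_Mapping.single i 1)"
  shows "P m"
proof (induction "deg m" arbitrary: m)
  case 0
  then show ?case using assms(1) deg_eq_0_iff by metis
next
  case (Suc k)
  then have "m \<noteq> 0" by auto
  then obtain i where i: "Poly_Mapping.lookup m i \<noteq> 0"
    by (auto simp: poly_mapping_eq_iff fun_eq_iff)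
  have "deg m = deg (m - Poly_Mapping.single i 1) + 1"
    by (subst add_single_minus[OF i]) (simp only: deg_add deg_single)
  then have "P (m - Poly_Mapping.single i 1)" using Suc by simp
  then show ?case using assms(2) add_single_minus[OF i] by metis
qed

lemma sum_single_lookup:
  "(\<Sum>m\<in>Poly_Mapping.keys p. Poly_Mapping.single m (Poly_Mapping.lookup p m)) = p"
proof (rule poly_mapping_eqI)
  fix k
  show "Poly_Mapping.lookup (\<Sum>m\<in>Poly_Mapping.keys p.
      Poly_Mapping.single m (Poly_Mapping.lookup p m)) k = Poly_Mapping.lookup p k"
    by (cases "k \<in> Poly_Mapping.keys p")
      (auto simp: lookup_sum lookup_single when_def in_keys_iff)
qed

lemma ypoly_single_induct [case_names single add]:
  fixes p :: "'a::comm_monoid_add ypoly"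
  assumes single: "\<And>m c. P (Poly_Mapping.single m c)"
    and add: "\<And>p q. P p \<Longrightarrow> P q \<Longrightarrow> P (p + q)"
  shows "P p"
proof -
  have "P (\<Sum>m\<in>A. Poly_Mapping.single m (Poly_Mapping.lookup p m))" for A
  proof (induction A rule: infinite_finite_induct)
    case empty
    then show ?case using single[of 0 0] by simp
  next
    case (infinite A)
    then show ?case using single[of 0 0] by simp
  qed (auto intro: assms)
  then show ?thesis using sum_single_lookup[of p] by metis
qed

lemma Const_0 [simp]: "Const 0 = 0" and Const_1 [simp]: "Const 1 = 1"
  by (simp_all add: Const_def)

lemma scale_of_nat: "scale (of_nat k) p = of_nat k * p"
  by (simp add: scale_def Const_def)

lemma scale_of_int: "scale (of_int k) p = of_int k * p"
  by (simp add: scale_def Const_def)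

lemma scale_numeral: "scale (numeral k) p = numeral k * p"
  by (simp add: scale_def Const_def)

lemma scale_uminus: "scale (- c) p = - scale c p"
  by (simp add: scale_def Const_def single_uminus)

lemma single_eq_scale: "Poly_Mapping.single m c = scale c (Poly_Mapping.single m 1)"
  by (simp add: scale_def Const_def mult_single)

lemma single_add_single:
  "Poly_Mapping.single (m + Poly_Mapping.single i 1) (1 :: 'a::comm_ring_1)
    = Poly_Mapping.single m 1 * Y i"
  by (simp add: Y_def mult_single)

text \<open>Reduces equality and local nilpotency of derivations to their values on the
  variables.\<close>

lemma ypoly_induct [case_names Const Y add mult]:
  fixes p :: "'a::comm_ring_1 ypoly"
  assumes "\<And>c. P (Const c)" "\<And>i. P (Y i)"
    and "\<And>p q. P p \<Longrightarrow> P q \<Longrightarrow> P (p + q)" "\<And>p q. P p \<Longrightarrow> P q \<Longrightarrow> P (p * q)"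
  shows "P p"
proof (induction p rule: ypoly_single_induct)
  case (single m c)
  have "P (Poly_Mapping.single m 1)"
  proof (induction m rule: exponent_induct)
    case zero
    then show ?case using assms(1)[of 1] by simp
  next
    case (add m i)
    then show ?case unfolding single_add_single by (intro assms)
  qed
  then show ?case unfolding single_eq_scale[of m c] scale_def by (intro assms)
qed (rule assms(3))

section \<open>General facts on derivations\<close>

definition derivation :: "('a::comm_ring_1 ypoly \<Rightarrow> 'a ypoly) \<Rightarrow> bool" where
  "derivation D \<longleftrightarrow> (\<forall>p q. D (p + q) = D p + D q) \<and> (\<forall>p q. D (p * q) = D p * q + p * D q)
    \<and> (\<forall>c. D (Const c) = 0)"

lemma derivation_add: "derivation D \<Longrightarrow> D (p + q) = D p + D q"
  and derivation_mult: "derivation D \<Longrightarrow> D (p * q) = D p * q + p * D q"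
  and derivation_Const: "derivation D \<Longrightarrow> D (Const c) = 0"
  by (auto simp: derivation_def)

lemma derivation_0: "derivation D \<Longrightarrow> D 0 = 0"
  using derivation_Const[of D 0] by simp

lemma derivation_1: "derivation D \<Longrightarrow> D 1 = 0"
  using derivation_Const[of D 1] by simp

lemma derivation_scale: "derivation D \<Longrightarrow> D (scale c p) = scale c (D p)"
  by (simp add: scale_def derivation_mult derivation_Const)

lemma derivation_minus: "derivation D \<Longrightarrow> D (- p) = - D p"
  using derivation_add[of D p "- p"] by (simp add: derivation_0 eq_neg_iff_add_eq_0 add.commute)

lemma derivation_sum: "derivation D \<Longrightarrow> D (\<Sum>i\<in>A. f i) = (\<Sum>i\<in>A. D (f i))"
  by (induction A rule: infinite_finite_induct) (auto simp: derivation_0 derivation_add)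

lemma derivation_of_int: "derivation D \<Longrightarrow> D (of_int k) = 0"
  using derivation_Const[of D "of_int k"] by (simp add: Const_def)

lemma derivation_of_nat: "derivation D \<Longrightarrow> D (of_nat k) = 0"
  using derivation_Const[of D "of_nat k"] by (simp add: Const_def)

lemma derivation_eqI:
  assumes "derivation D" "derivation E" "\<And>i. D (Y i) = E (Y i)"
  shows "D p = E p"
  by (induction p rule: ypoly_induct)
    (auto simp: assms derivation_add derivation_mult derivation_Const)

lemma derivation_lincomb:
  assumes "\<And>i. i \<in> A \<Longrightarrow> derivation (D i)"
  shows "derivation (\<lambda>p. \<Sum>i\<in>A. g i * D i p)"
  unfolding derivation_def using assms
  by (auto simp: derivation_add derivation_mult derivation_Const sum.distrib[symmetric]
      sum_distrib_left sum_distrib_right algebra_simps intro!: sum.cong sum.neutral)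

lemma derivation_commutator:
  assumes "derivation D" "derivation E"
  shows "derivation (\<lambda>p. D (E p) - E (D p))"
  unfolding derivation_def using assms
  by (simp add: derivation_add derivation_mult derivation_Const derivation_0 algebra_simps)

lemma derivation_zero: "derivation (\<lambda>p. 0)"
  by (simp add: derivation_def)

lemma derivation_scale_left: "derivation D \<Longrightarrow> derivation (\<lambda>p. scale c (D p))"
  by (auto simp: derivation_def scale_def algebra_simps)

section \<open>Partial derivatives and the commutation relations\<close>

lemma partial_deriv_superset:
  assumes "finite A" "Poly_Mapping.keys p \<subseteq> A"
  shows "partial_deriv i p = (\<Sum>m\<in>A. Poly_Mapping.single (m - Poly_Mapping.single i 1)
        (Poly_Mapping.lookup p m * of_nat (Poly_Mapping.lookup m i)))"
  unfolding partial_deriv_def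
  by (rule sum.mono_neutral_left) (use assms in \<open>auto simp: in_keys_iff\<close>)

lemma partial_deriv_single:
  "partial_deriv i (Poly_Mapping.single m c)
    = Poly_Mapping.single (m - Poly_Mapping.single i 1) (c * of_nat (Poly_Mapping.lookup m i))"
  by (subst partial_deriv_superset[of "{m}"]) auto

lemma partial_deriv_add: "partial_deriv i (p + q) = partial_deriv i p + partial_deriv i q"
proof -
  let ?A = "Poly_Mapping.keys p \<union> Poly_Mapping.keys q"
  have "partial_deriv i (p + q) = (\<Sum>m\<in>?A. Poly_Mapping.single (m - Poly_Mapping.single i 1)
        (Poly_Mapping.lookup (p + q) m * of_nat (Poly_Mapping.lookup m i)))"
    by (rule partial_deriv_superset) (use keys_add[of p q] in auto)
  also have "\<dots> = partial_deriv i p + partial_deriv i q"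
    by (simp add: partial_deriv_superset[of ?A] lookup_add distrib_right single_add sum.distrib)
  finally show ?thesis .
qed

lemma partial_deriv_mult:
  "partial_deriv i (p * q) = partial_deriv i p * q + p * partial_deriv i q"
proof (induction p rule: ypoly_single_induct)
  case (single m c)
  show ?case
  proof (induction q rule: ypoly_single_induct)
    case (single m' c')
    let ?e = "Poly_Mapping.single i 1 :: nat \<Rightarrow>\<^sub>0 nat"
    \<comment> \<open>If the variable does not occur in \<open>m\<close>, truncated subtraction can
      make the two exponents differ, but then both coefficients are zero.\<close>
    have "Poly_Mapping.single (m + m' - ?e) (c * c' * of_nat (Poly_Mapping.lookup m i))
        = Poly_Mapping.single (m - ?e + m') (c * c' * of_nat (Poly_Mapping.lookup m i))"
      for m m' :: "nat \<Rightarrow>\<^sub>0 nat"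
    proof (cases "Poly_Mapping.lookup m i = 0")
      case False
      then have "m + m' - ?e = m - ?e + m'"
        by (intro poly_mapping_eqI) (auto simp: lookup_add lookup_minus lookup_single when_def)
      then show ?thesis by simp
    qed simp
    from this[of m m'] this[of m' m] show ?case
      by (simp add: mult_single partial_deriv_single lookup_add distrib_left single_add
          add.commute mult.assoc mult.left_commute)
         (simp add: ac_simps)
  qed (simp add: partial_deriv_add algebra_simps)
qed (simp add: partial_deriv_add algebra_simps)

lemma derivation_partial_deriv: "derivation (partial_deriv i)"
  unfolding derivation_def
  by (auto simp: partial_deriv_add partial_deriv_mult Const_def partial_deriv_single)

lemma partial_deriv_Y: "partial_deriv i (Y j) = (if i = j then 1 else 0)"
  by (simp add: Y_def partial_deriv_single lookup_single when_def)

lemma derivation_xder: "derivation (xder n)"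
  unfolding xder_def by (intro derivation_lincomb derivation_partial_deriv)

lemma derivation_fhat: "derivation (fhat n)"
  unfolding fhat_def by (intro derivation_lincomb derivation_partial_deriv)

lemma derivation_hhat: "derivation (hhat n)"
  unfolding hhat_def by (intro derivation_commutator derivation_xder derivation_fhat)

lemma xder_Y: "xder n (Y j) = (if 1 \<le> j \<and> j \<le> n then Y (j - 1) else 0)"
proof -
  have "xder n (Y j) = (\<Sum>i<n. if i = j - 1 \<and> 1 \<le> j then Y i else 0)"
    unfolding xder_def by (rule sum.cong) (auto simp: partial_deriv_Y)
  also have "\<dots> = (if 1 \<le> j \<and> j \<le> n then Y (j - 1) else 0)"
    by (cases "1 \<le> j") auto
  finally show ?thesis .
qed

lemma fhat_Y: "fhat n (Y j) = of_nat ((j + 1) * (n - j)) * Y (j + 1)"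
proof -
  have "fhat n (Y j) = (\<Sum>i\<le>n. if i = j then of_nat ((j + 1) * (n - j)) * Y (j + 1) else 0)"
    unfolding fhat_def scale_of_nat by (rule sum.cong) (auto simp: partial_deriv_Y)
  then show ?thesis by (cases "j \<le> n") simp_all
qed

text \<open>For j \<le> n the eigenvalue is \<open>(j + 1) * (n - j) - j * (n - j + 1)\<close>. Both
  \<open>xder n\<close> and \<open>fhat n\<close> kill the variables beyond index \<open>n\<close>;
  these get weight 0, so the sl2 relations hold on the whole ring.\<close>

lemma hhat_Y: "hhat n (Y j) = of_int (if j \<le> n then int n - 2 * int j else 0) * Y j"
proof (cases "j \<le> n")
  case True
  then obtain d where n: "n = j + d" using le_Suc_ex by blast
  show ?thesis
    by (cases j; cases d)
      (simp_all add: hhat_def xder_Y fhat_Y derivation_0[OF derivation_fhat]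
        derivation_0[OF derivation_xder] derivation_mult[OF derivation_xder] derivation_of_nat[OF derivation_xder] n
        del: of_nat_Suc of_nat_mult of_nat_add, simp_all add: algebra_simps)
next
  case False
  then show ?thesis
    by (auto simp: hhat_def xder_Y fhat_Y derivation_0[OF derivation_fhat]
        derivation_0[OF derivation_xder])
qed

text \<open>Both the commutator and \<open>2 * x\<close> are derivations, so comparing them on
  variables suffices; there \<open>x\<close> lowers the index by 1 and thereby raises the weight by
  2.\<close>

lemma hhat_xder:
  fixes p :: "'a::comm_ring_1 ypoly"
  shows "hhat n (xder n p) = xder n (hhat n p) + scale 2 (xder n p)"
proof -
  have "hhat n (xder n (Y i)) - xder n (hhat n (Y i)) = scale 2 (xder n (Y i :: 'a ypoly))" for i
  proof (cases "1 \<le> i \<and> i \<le> n")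
    case True
    define w where "w = int n - 2 * int i"
    have "hhat n (Y (i - 1) :: 'a ypoly) = of_int (w + 2) * Y (i - 1)"
      using True by (auto simp: hhat_Y w_def of_nat_diff algebra_simps)
    moreover have "hhat n (Y i :: 'a ypoly) = of_int w * Y i"
      using True by (simp add: hhat_Y w_def)
    ultimately show ?thesis
      using True by (simp add: xder_Y derivation_mult[OF derivation_xder]
          derivation_of_int[OF derivation_xder] scale_numeral distrib_right)
  next
    case False
    then have 0: "xder n (Y i :: 'a ypoly) = 0" by (auto simp: xder_Y)
    then show ?thesis
      by (simp add: hhat_Y derivation_mult[OF derivation_xder] derivation_of_int[OF derivation_xder]
          derivation_0[OF derivation_hhat] derivation_0[OF derivation_xder] scale_numeral
          del: of_int_diff)
  qed
  then have "hhat n (xder n p) - xder n (hhat n p) = scale 2 (xder n p)"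
    by (rule derivation_eqI[OF derivation_commutator[OF derivation_hhat derivation_xder]
          derivation_scale_left[OF derivation_xder]])
  then show ?thesis by (simp add: algebra_simps)
qed

lemma hhat_fhat:
  fixes p :: "'a::comm_ring_1 ypoly"
  shows "hhat n (fhat n p) = fhat n (hhat n p) - scale 2 (fhat n p)"
proof -
  have "hhat n (fhat n (Y i)) - fhat n (hhat n (Y i)) = scale (-2) (fhat n (Y i :: 'a ypoly))" for i
  proof (cases "i < n")
    case True
    define w where "w = int n - 2 * int i"
    have "hhat n (Y (i + 1) :: 'a ypoly) = of_int (w - 2) * Y (i + 1)"
      using True by (simp add: hhat_Y w_def algebra_simps)
    moreover have "hhat n (Y i :: 'a ypoly) = of_int w * Y i"
      using True by (simp add: hhat_Y w_def)
    ultimately show ?thesis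
      by (simp only: fhat_Y derivation_mult[OF derivation_fhat] derivation_of_int[OF derivation_fhat]
          derivation_mult[OF derivation_hhat] derivation_of_nat[OF derivation_hhat]
          scale_uminus scale_numeral of_int_diff)
        (simp add: algebra_simps)
  next
    case False
    then have 0: "fhat n (Y i :: 'a ypoly) = 0" by (simp add: fhat_Y)
    then show ?thesis
      by (simp add: hhat_Y derivation_mult[OF derivation_fhat] derivation_of_int[OF derivation_fhat]
          derivation_0[OF derivation_hhat] derivation_0[OF derivation_fhat] scale_uminus scale_numeral
          del: of_int_diff)
  qed
  then have "hhat n (fhat n p) - fhat n (hhat n p) = scale (-2) (fhat n p)"
    by (rule derivation_eqI[OF derivation_commutator[OF derivation_hhat derivation_fhat]
          derivation_scale_left[OF derivation_fhat]])
  then show ?thesis by (simp add: scale_uminus algebra_simps)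
qed

section \<open>Local nilpotency\<close>

lemma derivation_nilpotent_mult:
  assumes "derivation D" "(D ^^ N) p = 0" "(D ^^ M) q = 0"
  shows "(D ^^ (N + M)) (p * q) = 0"
  using assms(2,3)
proof (induction "N + M" arbitrary: N M p q)
  case (Suc k)
  have zero: "(D ^^ i) 0 = 0" for i
    by (induction i) (auto simp: derivation_0[OF assms(1)])
  have add: "(D ^^ i) (p + q) = (D ^^ i) p + (D ^^ i) q" for i p q
    by (induction i) (auto simp: derivation_add[OF assms(1)])
  show ?case
  proof (cases "N = 0 \<or> M = 0")
    case True
    then show ?thesis using Suc.prems by (auto simp: zero)
  next
    case False
    then obtain N' M' where NM: "N = Suc N'" "M = Suc M'"
      by (metis not0_implies_Suc)
    then have k: "k = N' + M" "k = N + M'"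
      using Suc.hyps(2) by auto
    \<comment> \<open>The Leibniz rule gives two summands, each with one of the two exponents
      lowered by 1, so the induction on \<open>N + M\<close> covers both.\<close>
    have "(D ^^ (N' + M)) (D p * q) = 0"
      by (rule Suc.hyps(1)) (use Suc NM in \<open>auto simp: funpow_swap1\<close>)
    moreover have "(D ^^ (N + M')) (p * D q) = 0"
      by (rule Suc.hyps(1)) (use Suc NM in \<open>auto simp: funpow_swap1\<close>)
    ultimately have "(D ^^ k) (D p * q) + (D ^^ k) (p * D q) = 0"
      unfolding k(1)[symmetric] k(2)[symmetric] by simp
    then have "(D ^^ k) (D (p * q)) = 0"
      by (simp only: derivation_mult[OF assms(1)] add)
    then show ?thesis
      using Suc.hyps(2)[symmetric] by (simp add: funpow_swap1)
  qed
qed simp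

lemma derivation_locally_nilpotent:
  assumes D: "derivation D" and Y: "\<And>i. \<exists>N. (D ^^ N) (Y i) = 0"
  shows "\<exists>N. (D ^^ N) p = 0"
proof (induction p rule: ypoly_induct)
  case (Const c)
  have "(D ^^ 1) (Const c) = 0" using derivation_Const[OF D] by simp
  then show ?case by blast
next
  case (add p q)
  then obtain N M where NM: "(D ^^ N) p = 0" "(D ^^ M) q = 0" by blast
  have zero: "(D ^^ i) 0 = 0" for i
    by (induction i) (auto simp: derivation_0[OF D])
  have "(D ^^ (M + N)) p = 0" "(D ^^ (N + M)) q = 0"
    using NM by (simp_all add: funpow_add zero)
  moreover have "(D ^^ i) (p + q) = (D ^^ i) p + (D ^^ i) q" for i p q
    by (induction i) (auto simp: derivation_add[OF D])
  ultimately have "(D ^^ (N + M)) (p + q) = 0"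
    by (simp add: add.commute)
  then show ?case by blast
qed (use Y derivation_nilpotent_mult[OF D] in blast)+

lemma xder_nilpotent: "\<exists>N. (xder n ^^ N) p = 0"
proof (rule derivation_locally_nilpotent[OF derivation_xder])
  fix i :: nat
  have "(xder n ^^ Suc i) (Y i) = 0" for i
  proof (induction i)
    case (Suc i)
    have zero: "(xder n ^^ j) 0 = 0" for j
      by (induction j) (auto simp: derivation_0[OF derivation_xder])
    show ?case
      using Suc unfolding funpow_Suc_right[of "Suc i"] by (auto simp: xder_Y zero simp del: funpow.simps)
  qed (simp add: xder_Y)
  then show "\<exists>N. (xder n ^^ N) (Y i) = 0" by blast
qed

lemma fhat_nilpotent:
  fixes p :: "'a::comm_ring_1 ypoly"
  shows "\<exists>N. (fhat n ^^ N) p = 0"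
proof (rule derivation_locally_nilpotent[OF derivation_fhat])
  fix i :: nat
  show "\<exists>N. (fhat n ^^ N) (Y i :: 'a ypoly) = 0"
  proof (induction "n - i" arbitrary: i)
    case 0
    then have "(fhat n ^^ 1) (Y i) = 0" by (simp add: fhat_Y)
    then show ?case by blast
  next
    case (Suc k)
    then have "k = n - Suc i" by simp
    then obtain N where N: "(fhat n ^^ N) (Y (Suc i) :: 'a ypoly) = 0"
      using Suc.hyps(1) by blast
    have "(fhat n ^^ j) (scale c p) = scale c ((fhat n ^^ j) p)" for j c and p :: "'a ypoly"
      by (induction j) (auto simp: derivation_scale[OF derivation_fhat])
    moreover have "fhat n (Y i :: 'a ypoly) = scale (of_nat ((i + 1) * (n - i))) (Y (Suc i))"
      by (simp only: fhat_Y scale_of_nat Suc_eq_plus1)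
    ultimately have "(fhat n ^^ Suc N) (Y i :: 'a ypoly) = scale (of_nat ((i + 1) * (n - i))) 0"
      using N by (simp only: funpow_Suc_right o_apply)
    then have "(fhat n ^^ Suc N) (Y i :: 'a ypoly) = 0"
      by (simp only: scale_def mult_zero_right)
    then show ?case by blast
  qed
qed

section \<open>Homogeneous components and Euler's identity\<close>

lemma in_Vhom_iff: "p \<in> Vhom n k \<longleftrightarrow>
    (\<forall>m\<in>Poly_Mapping.keys p. Poly_Mapping.keys m \<subseteq> {..n} \<and> deg m = k)"
  by (auto simp: Vhom_def polys_def homogeneous_def deg_def)

lemma Vhom_0: "0 \<in> Vhom n k"
  by (simp add: in_Vhom_iff)

lemma Vhom_add: "p \<in> Vhom n k \<Longrightarrow> q \<in> Vhom n k \<Longrightarrow> p + q \<in> Vhom n k"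
  using keys_add[of p q] by (force simp: in_Vhom_iff)

lemma Vhom_sum: "(\<And>i. i \<in> A \<Longrightarrow> f i \<in> Vhom n k) \<Longrightarrow> (\<Sum>i\<in>A. f i) \<in> Vhom n k"
  by (induction A rule: infinite_finite_induct) (auto intro: Vhom_0 Vhom_add)

lemma Vhom_mult:
  assumes "p \<in> Vhom n k" "q \<in> Vhom n l"
  shows "p * q \<in> Vhom n (k + l)"
  unfolding in_Vhom_iff
proof
  fix m assume "m \<in> Poly_Mapping.keys (p * q)"
  then obtain a b where "a \<in> Poly_Mapping.keys p" "b \<in> Poly_Mapping.keys q" "m = a + b"
    using keys_mult[of p q] by blast
  then show "Poly_Mapping.keys m \<subseteq> {..n} \<and> deg m = k + l"
    using assms keys_add[of a b] by (fastforce simp: in_Vhom_iff deg_add)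
qed

lemma Vhom_Const: "Const c \<in> Vhom n 0"
  by (simp add: in_Vhom_iff Const_def)

lemma Vhom_scale: "p \<in> Vhom n k \<Longrightarrow> scale c p \<in> Vhom n k"
  using Vhom_mult[OF Vhom_Const, of p n k c] by (simp add: scale_def)

lemma Vhom_Y: "i \<le> n \<Longrightarrow> (Y i :: 'a::zero_neq_one ypoly) \<in> Vhom n 1"
  by (simp add: in_Vhom_iff Y_def)

lemma Vhom_zero_degree:
  assumes "p \<in> Vhom n 0" obtains c where "p = Const c"
proof
  show "p = Const (Poly_Mapping.lookup p 0)"
    using assms by (intro poly_mapping_eqI)
     (auto simp: in_Vhom_iff deg_eq_0_iff Const_def lookup_single when_def in_keys_iff)
qed

lemma Vhom_single: "Poly_Mapping.keys m \<subseteq> {..n} \<Longrightarrow> Poly_Mapping.single m c \<in> Vhom n (deg m)"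
  by (simp add: in_Vhom_iff)

lemma derivation_Vhom:
  assumes D: "derivation D" and Y: "\<And>i. i \<le> n \<Longrightarrow> D (Y i) \<in> Vhom n 1" and p: "p \<in> Vhom n k"
  shows "D p \<in> Vhom n k"
proof -
  have single: "Poly_Mapping.keys m \<subseteq> {..n} \<Longrightarrow> D (Poly_Mapping.single m 1) \<in> Vhom n (deg m)" for m
  proof (induction m rule: exponent_induct)
    case zero
    then show ?case by (simp add: derivation_1[OF D] Vhom_0)
  next
    case (add m i)
    then have "Poly_Mapping.keys m \<subseteq> {..n}" "i \<le> n" by (auto simp: keys_add_nat)
    with add.IH have "D (Poly_Mapping.single m 1) * Y i + Poly_Mapping.single m 1 * D (Y i) \<in> Vhom n (deg m + 1)"
      by (intro Vhom_add Vhom_mult Y Vhom_Y Vhom_single) auto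
    then show ?case unfolding single_add_single by (simp add: derivation_mult[OF D] deg_add)
  qed
  have "D (Poly_Mapping.single m c) \<in> Vhom n k" if "m \<in> Poly_Mapping.keys p" for m c
    unfolding single_eq_scale[of m c] derivation_scale[OF D]
    using single[of m] p that by (intro Vhom_scale) (auto simp: in_Vhom_iff)
  then have "(\<Sum>m\<in>Poly_Mapping.keys p. D (Poly_Mapping.single m (Poly_Mapping.lookup p m))) \<in> Vhom n k"
    by (intro Vhom_sum)
  then show ?thesis
    by (simp only: derivation_sum[OF D, symmetric] sum_single_lookup)
qed

lemma xder_Vhom: "p \<in> Vhom n k \<Longrightarrow> xder n p \<in> Vhom n k"
  by (rule derivation_Vhom[OF derivation_xder]) (auto simp: xder_Y Vhom_0 intro: Vhom_Y[simplified])

lemma fhat_Vhom: "p \<in> Vhom n k \<Longrightarrow> fhat n p \<in> Vhom n k"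
proof (rule derivation_Vhom[OF derivation_fhat])
  fix i assume "i \<le> n"
  then show "fhat n (Y i :: 'a ypoly) \<in> Vhom n 1"
    by (cases "i = n") (auto simp: fhat_Y Vhom_0 simp flip: scale_of_nat
        simp del: of_nat_mult of_nat_diff of_nat_Suc intro!: Vhom_scale Vhom_Y[simplified])
qed

lemma partial_deriv_Vhom:
  assumes "p \<in> Vhom n (Suc k)"
  shows "partial_deriv i p \<in> Vhom n k"
  unfolding partial_deriv_def
proof (rule Vhom_sum)
  fix m assume "m \<in> Poly_Mapping.keys p"
  then have m: "Poly_Mapping.keys m \<subseteq> {..n}" "deg m = Suc k"
    using assms by (auto simp: in_Vhom_iff)
  let ?m = "m - Poly_Mapping.single i 1"
  show "Poly_Mapping.single ?m (Poly_Mapping.lookup p m * of_nat (Poly_Mapping.lookup m i)) \<in> Vhom n k"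
  proof (cases "Poly_Mapping.lookup m i = 0")
    case False
    have "deg m = deg ?m + 1"
      by (subst add_single_minus[OF False]) (simp only: deg_add deg_single)
    moreover have "Poly_Mapping.keys ?m \<subseteq> Poly_Mapping.keys m"
      by (auto simp: in_keys_iff lookup_minus)
    ultimately show ?thesis using m Vhom_single[of ?m n] by (metis Suc_eq_plus1 diff_Suc_1 order_trans)
  qed (simp add: Vhom_0)
qed

lemma euler_identity:
  assumes "p \<in> Vhom n k"
  shows "(\<Sum>i\<le>n. Y i * partial_deriv i p) = of_nat k * p"
proof -
  have D: "derivation (\<lambda>p. \<Sum>i\<le>n. Y i * partial_deriv i p)"
    by (intro derivation_lincomb derivation_partial_deriv)
  have single: "(\<Sum>i\<le>n. Y i * partial_deriv i (Poly_Mapping.single m c)) = of_nat k * Poly_Mapping.single m c"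
    if "m \<in> Poly_Mapping.keys p" for m and c :: 'a
  proof -
    have "Y i * partial_deriv i (Poly_Mapping.single m c)
        = Poly_Mapping.single m (c * of_nat (Poly_Mapping.lookup m i))" for i
    proof (cases "Poly_Mapping.lookup m i = 0")
      case False
      then show ?thesis using add_single_minus[OF False]
        by (simp add: partial_deriv_single Y_def mult_single add.commute)
    qed (simp add: partial_deriv_single)
    then have "(\<Sum>i\<le>n. Y i * partial_deriv i (Poly_Mapping.single m c))
        = Poly_Mapping.single m (c * of_nat (\<Sum>i\<le>n. Poly_Mapping.lookup m i))"
      by (simp add: sum_distrib_left) (induction n, auto simp: single_add)
    also have "(\<Sum>i\<le>n. Poly_Mapping.lookup m i) = k"
      using assms that by (subst deg_superset) (auto simp: in_Vhom_iff)
    finally show ?thesis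
      by (simp add: mult_single mult.commute[of c] flip: single_of_nat)
  qed
  have "(\<Sum>i\<le>n. Y i * partial_deriv i p) = (\<Sum>m\<in>Poly_Mapping.keys p.
      \<Sum>i\<le>n. Y i * partial_deriv i (Poly_Mapping.single m (Poly_Mapping.lookup p m)))"
    by (simp only: derivation_sum[OF D, symmetric] sum_single_lookup)
  also have "\<dots> = of_nat k * (\<Sum>m\<in>Poly_Mapping.keys p. Poly_Mapping.single m (Poly_Mapping.lookup p m))"
    by (simp add: single sum_distrib_left)
  finally show ?thesis by (simp only: sum_single_lookup)
qed

lemma partial_deriv_xder:
  fixes p :: "'a::comm_ring_1 ypoly"
  shows "partial_deriv i (xder n p)
    = xder n (partial_deriv i p) + (if i < n then partial_deriv (Suc i) p else 0)"
proof -
  have D: "derivation (\<lambda>p :: 'a ypoly. partial_deriv i (xder n p) - xder n (partial_deriv i p))"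
    by (intro derivation_commutator derivation_partial_deriv derivation_xder)
  have Y: "partial_deriv i (xder n (Y j)) - xder n (partial_deriv i (Y j))
      = (if i < n then partial_deriv (Suc i) (Y j :: 'a ypoly) else 0)" for j
    by (auto simp: xder_Y partial_deriv_Y derivation_1[OF derivation_xder]
        derivation_0[OF derivation_xder] derivation_0[OF derivation_partial_deriv])
  have "partial_deriv i (xder n p) - xder n (partial_deriv i p)
      = (if i < n then partial_deriv (Suc i) p else 0)"
  proof (cases "i < n")
    case True
    then show ?thesis
      using derivation_eqI[OF D derivation_partial_deriv[of "Suc i"] Y[unfolded if_P[OF True]], of p]
      by simp
  next
    case False
    then show ?thesis
      using derivation_eqI[OF D derivation_zero Y[unfolded if_not_P[OF False]], of p] by simp
  qed
  then show ?thesis by (simp add: algebra_simps)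
qed

section \<open>Products with \<open>y\<^sub>0\<close>\<close>

lemma sl2_module_Vhom:
  "sl2_module (scale :: 'a::field_char_0 \<Rightarrow> _) (xder n) (fhat n) (hhat n) (Vhom n k)"
proof unfold_locales
  show "ypoly.subspace (Vhom n k :: 'a ypoly set)"
    by (simp add: ypoly.subspace_def Vhom_0 Vhom_add Vhom_scale)
qed (simp_all add: derivation_add[OF derivation_xder] derivation_add[OF derivation_fhat]
      derivation_scale[OF derivation_xder] derivation_scale[OF derivation_fhat]
      hhat_xder hhat_fhat xder_Vhom fhat_Vhom xder_nilpotent fhat_nilpotent, simp add: hhat_def)

lemma Z_comp_eq: "Z_comp n k = {p \<in> Vhom n k. xder n p = 0}"
  by (auto simp: Z_comp_def Z_def Vhom_def)

section \<open>Contraction with the variables\<close>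

definition contract :: "nat \<Rightarrow> 'a::comm_ring_1 ypoly \<Rightarrow> 'a ypoly" where
  "contract n p = (\<Sum>i\<le>n. (-1) ^ i * (xder n ^^ i) p * Y i)"

lemma derivation_minus_one_power:
  "derivation D \<Longrightarrow> D ((-1) ^ i * p) = (-1) ^ i * D p"
  by (cases "even i") (auto simp: derivation_minus)

lemma xderpow_add: "(xder n ^^ i) (p + q) = (xder n ^^ i) p + (xder n ^^ i) q"
  by (induction i) (auto simp: derivation_add[OF derivation_xder])

lemma xderpow_scale: "(xder n ^^ i) (scale c p) = scale c ((xder n ^^ i) p)"
  by (induction i) (auto simp: derivation_scale[OF derivation_xder])

lemma xderpow_0: "(xder n ^^ i) 0 = 0"
  by (induction i) (auto simp: derivation_0[OF derivation_xder])

lemma contract_0: "contract n 0 = 0"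
  by (simp add: contract_def xderpow_0)

lemma contract_add: "contract n (p + q) = contract n p + contract n q"
  by (simp add: contract_def xderpow_add algebra_simps sum.distrib)

lemma contract_scale: "contract n (scale c p) = scale c (contract n p)"
  by (simp add: contract_def xderpow_scale) (simp add: scale_def sum_distrib_left algebra_simps)

lemma contract_Vhom:
  assumes "p \<in> Vhom n k"
  shows "contract n p \<in> Vhom n (Suc k)"
proof -
  have "(xder n ^^ i) p \<in> Vhom n k" for i
    by (induction i) (auto simp: assms xder_Vhom)
  then have "scale ((-1) ^ i) ((xder n ^^ i) p) * Y i \<in> Vhom n (k + 1)" if "i \<le> n" for i
    using that by (intro Vhom_mult Vhom_scale Vhom_Y)
  moreover have "scale ((-1) ^ i) q = (-1) ^ i * q" for i and q :: "'a ypoly"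
    by (cases "even i") (simp_all add: scale_def Const_def single_uminus)
  ultimately show ?thesis unfolding contract_def by (intro Vhom_sum) auto
qed

text \<open>The alternating signs make the images telescope, since \<open>x\<close> maps
  \<open>Y (i + 1)\<close> to \<open>Y i\<close>. Only the boundary term containing
  \<open>(xder n ^^ Suc n) p\<close> survives.\<close>

lemma xder_contract:
  assumes "(xder n ^^ Suc n) p = 0"
  shows "xder n (contract n p) = 0"
proof -
  have leibniz: "xder n ((-1) ^ j * q * r) = (-1) ^ j * xder n q * r + (-1) ^ j * q * xder n r"
    for j q r
    by (cases "even j") (simp_all add: derivation_minus[OF derivation_xder]
        derivation_mult[OF derivation_xder])
  have "xder n (\<Sum>i\<le>N. (-1) ^ i * (xder n ^^ i) p * Y i) = (-1) ^ N * (xder n ^^ Suc N) p * Y N"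
    if "N \<le> n" for N
    using that
  proof (induction N)
    case 0
    then show ?case by (simp add: derivation_mult[OF derivation_xder] xder_Y)
  next
    case (Suc N)
    have "xder n (\<Sum>i\<le>Suc N. (-1) ^ i * (xder n ^^ i) p * Y i) = (-1) ^ N * (xder n ^^ Suc N) p * Y N
       + ((-1) ^ Suc N * (xder n ^^ Suc (Suc N)) p * Y (Suc N) + (-1) ^ Suc N * (xder n ^^ Suc N) p * Y N)"
      using Suc by (simp add: leibniz derivation_add[OF derivation_xder] xder_Y
          del: power_Suc)
    then show ?case by simp
  qed
  from this[of n] show ?thesis using assms by (simp add: contract_def)
qed

lemma hhat_mult:
  assumes "hhat n p = scale (of_int a) p" "hhat n q = scale (of_int b) q"
  shows "hhat n (p * q) = scale (of_int (a + b)) (p * q)"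
  using assms unfolding scale_of_int
  by (simp add: derivation_mult[OF derivation_hhat] algebra_simps)

text \<open>In every summand the gain \<open>2 * i\<close> from \<open>x\<close> cancels the drop in
  \<open>n - 2 * i\<close>, the weight of \<open>Y i\<close>.\<close>

lemma hhat_contract:
  fixes p :: "'a::field_char_0 ypoly"
  assumes "hhat n p = scale (of_int a) p"
  shows "hhat n (contract n p) = scale (of_int (a + int n)) (contract n p)"
proof -
  interpret sl2: sl2_module "scale :: 'a \<Rightarrow> _" "xder n" "fhat n" "hhat n" "Vhom n k" for k
    by (rule sl2_module_Vhom)
  have "hhat n ((-1) ^ i * (xder n ^^ i) p * Y i)
      = scale (of_int (a + int n)) ((-1) ^ i * (xder n ^^ i) p * Y i)" if "i \<le> n" for i
  proof -
    have "hhat n ((xder n ^^ i) p) = scale (of_int (a + 2 * int i)) ((xder n ^^ i) p)"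
      using sl2.weight_Xpow[of a p i] assms by (simp only: sl2.weight_def)
    moreover have "hhat n (Y i :: 'a ypoly) = scale (of_int (int n - 2 * int i)) (Y i)"
      using that by (simp only: hhat_Y scale_of_int if_True)
    ultimately have "hhat n ((xder n ^^ i) p * Y i)
        = scale (of_int (a + 2 * int i + (int n - 2 * int i))) ((xder n ^^ i) p * Y i)"
      by (rule hhat_mult)
    then show ?thesis
      by (simp add: mult.assoc derivation_minus_one_power[OF derivation_hhat] scale_def)
  qed
  then show ?thesis
    by (simp add: contract_def derivation_sum[OF derivation_hhat] ypoly.scale_sum_right)
qed

lemma xderpow_partial_deriv:
  assumes "xder n u = 0" "i \<le> n"
  shows "(xder n ^^ i) (partial_deriv 0 u) = (-1) ^ i * partial_deriv i u"
  using assms(2)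
proof (induction i)
  case (Suc i)
  then have "xder n (partial_deriv i u) = - partial_deriv (Suc i) u"
    using partial_deriv_xder[of i n u] assms(1)
    by (simp add: derivation_0[OF derivation_partial_deriv] eq_neg_iff_add_eq_0)
  then show ?case using Suc
    by (simp add: derivation_minus_one_power[OF derivation_xder])
qed simp

text \<open>At the last index the commutator of the partial derivative with \<open>x\<close> is
  zero, so \<open>x\<close> annihilates \<open>partial_deriv n u\<close>.\<close>

lemma xderpow_partial_deriv_eq_0:
  assumes "xder n u = 0"
  shows "(xder n ^^ Suc n) (partial_deriv 0 u) = 0"
  using partial_deriv_xder[of n n u] assms
  by (simp add: xderpow_partial_deriv derivation_minus_one_power[OF derivation_xder]
      derivation_0[OF derivation_partial_deriv])

lemma contract_partial_deriv:
  assumes "u \<in> Vhom n (Suc k)" "xder n u = 0"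
  shows "contract n (partial_deriv 0 u) = of_nat (Suc k) * u"
proof -
  have "(-1) ^ i * ((-1) ^ i * partial_deriv i u) * Y i = Y i * partial_deriv i u" for i
    by (cases "even i") simp_all
  then have "contract n (partial_deriv 0 u) = (\<Sum>i\<le>n. Y i * partial_deriv i u)"
    by (simp add: contract_def xderpow_partial_deriv assms(2) mult.commute)
  then show ?thesis using euler_identity[OF assms(1)] by (simp only:)
qed

section \<open>The products expressed by contraction\<close>

lemma lift_eq_scale_fhatpow:
  fixes v :: "'a::field_char_0 ypoly"
  assumes "int d \<le> a"
  shows "\<exists>c. c \<noteq> 0 \<and> lift n a v d = scale c ((fhat n ^^ d) v)"
  using assms
proof (induction d)
  case 0
  show ?case by (intro exI[of _ 1]) simp
next
  case (Suc d)
  then obtain c where "c \<noteq> 0" "lift n a v d = scale c ((fhat n ^^ d) v)" by auto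
  \<comment> \<open>The second factor is \<open>a - d\<close>, positive by the bound on
    \<open>Suc d\<close>, so characteristic zero keeps the denominator nonzero.\<close>
  moreover have "(of_nat (Suc d) * of_int (a - int (Suc d) + 1) :: 'a) \<noteq> 0"
    using Suc.prems by (simp only: mult_eq_0_iff of_nat_eq_0_iff of_int_eq_0_iff) linarith
  ultimately show ?case
    by (intro exI[of _ "1 / (of_nat (Suc d) * of_int (a - int (Suc d) + 1)) * c"])
      (simp add: derivation_scale[OF derivation_fhat] del: of_nat_Suc)
qed

text \<open>The denominator in \<open>lift\<close> is exactly the coefficient
  \<open>(d + 1) * (a - d)\<close> produced when \<open>x\<close> meets
  \<open>fhat ^^ Suc d\<close>; with this normalisation \<open>x\<close> undoes one lifting
  step.\<close>

lemma xder_lift: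
  fixes v :: "'a::field_char_0 ypoly"
  assumes "xder n v = 0" "hhat n v = scale (of_int a) v" "int (Suc d) \<le> a"
  shows "xder n (lift n a v (Suc d)) = lift n a v d"
proof -
  interpret sl2: sl2_module "scale :: 'a \<Rightarrow> _" "xder n" "fhat n" "hhat n" "Vhom n 0"
    by (rule sl2_module_Vhom)
  have wt: "sl2.weight a v" using assms(2) by (simp add: sl2.weight_def)
  define r where "r = (of_nat (Suc d) * of_int (a - int (Suc d) + 1) :: 'a)"
  obtain c where c: "lift n a v d = scale c ((fhat n ^^ d) v)"
    using lift_eq_scale_fhatpow[of d a n v] assms(3) by auto
  have "r \<noteq> 0"
    using assms(3) by (simp only: r_def mult_eq_0_iff of_nat_eq_0_iff of_int_eq_0_iff) linarith
  have "xder n (lift n a v (Suc d)) = scale (1 / r) (scale c (xder n ((fhat n ^^ Suc d) v)))"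
    by (simp add: c derivation_scale[OF derivation_fhat] derivation_scale[OF derivation_xder]
        r_def del: of_nat_Suc)
  also have "xder n ((fhat n ^^ Suc d) v) = scale r ((fhat n ^^ d) v)"
    unfolding sl2.X_Fpow_Suc[OF assms(1) wt] r_def by simp
  finally show ?thesis using \<open>r \<noteq> 0\<close> by (simp add: c)
qed

lemma xderpow_lift:
  fixes v :: "'a::field_char_0 ypoly"
  assumes "xder n v = 0" "hhat n v = scale (of_int a) v" "int d \<le> a"
  shows "(xder n ^^ i) (lift n a v d) = (if i \<le> d then lift n a v (d - i) else 0)"
proof (induction i)
  case (Suc i)
  show ?case
  proof (cases "i < d")
    case True
    then obtain e where "d - i = Suc e" "d - Suc i = e" by (metis Suc_diff_Suc)
    then show ?thesis
      using Suc True assms(3) xder_lift[OF assms(1,2), of e] by (simp del: lift.simps)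
  next
    case False
    then show ?thesis using Suc assms(1) by (auto simp: derivation_0[OF derivation_xder])
  qed
qed simp

text \<open>For eigenvalue \<open>n\<close> the normalising denominators coincide with the factors
  \<open>(i + 1) * (n - i)\<close> in the definition of \<open>fhat\<close> on variables.\<close>

lemma lift_Y0:
  "i \<le> n \<Longrightarrow> lift n (int n) (Y 0) i = (Y i :: 'a::field_char_0 ypoly)"
proof (induction i)
  case (Suc i)
  obtain e where n: "n = Suc i + e" using Suc.prems le_Suc_ex by blast
  have r: "(of_nat (Suc i) * of_int (int n - int (Suc i) + 1) :: 'a) = of_nat ((i + 1) * (n - i))"
    by (simp add: n algebra_simps)
  have "of_nat ((i + 1) * (n - i)) \<noteq> (0 :: 'a)"
    unfolding of_nat_eq_0_iff using Suc.prems by simp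
  then show ?case
    using Suc by (simp only: lift.simps r fhat_Y Suc_leD flip: scale_of_nat) simp
qed simp

lemma eigenvalue_eq:
  fixes u :: "'a::field_char_0 ypoly"
  assumes "u \<noteq> 0" "hhat n u = scale (of_int a) u"
  shows "eigenvalue n u = a"
  unfolding eigenvalue_def eigenvector_def
  by (rule the_equality) (use assms in auto)

lemma hhat_Y0: "hhat n (Y 0) = scale (of_int (int n)) (Y 0)"
  by (simp only: hhat_Y scale_of_int) simp

lemma Y_neq_0: "Y i \<noteq> (0 :: 'a::zero_neq_one ypoly)"
  by (metis Y_def lookup_single_eq lookup_zero zero_neq_one)

text \<open>The lifts of \<open>Y 0\<close> are the variables. Reversing the summation puts
  \<open>lift n a v (d - i)\<close> next to \<open>Y i\<close>, and this lift is
  \<open>x ^^ i\<close> applied to \<open>lift n a v d\<close>. The terms of \<open>contract\<close>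
  with \<open>i > d\<close> vanish, as \<open>x\<close> kills \<open>v\<close>.\<close>

lemma circ_Y0:
  fixes v :: "'a::field_char_0 ypoly"
  assumes "xder n v = 0" "hhat n v = scale (of_int a) v" "v \<noteq> 0" "int d \<le> a" "d \<le> n"
  shows "circ n d v (Y 0) = (-1) ^ d * contract n (lift n a v d)"
proof -
  have "circ n d v (Y 0) = (\<Sum>i\<le>d. (-1) ^ i * lift n a v i * Y (d - i))"
    unfolding circ_def eigenvalue_eq[OF assms(3,2)] eigenvalue_eq[OF Y_neq_0 hhat_Y0]
    by (rule sum.cong) (use assms(5) in \<open>auto simp: lift_Y0\<close>)
  also have "\<dots> = (\<Sum>i\<le>d. (-1) ^ (d - i) * lift n a v (d - i) * Y i)"
    by (rule sum.reindex_bij_witness[of _ "\<lambda>i. d - i" "\<lambda>i. d - i"]) auto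
  also have "\<dots> = (\<Sum>i\<le>d. (-1) ^ d * ((-1) ^ i * (xder n ^^ i) (lift n a v d) * Y i))"
  proof (rule sum.cong)
    fix i assume "i \<in> {..d}"
    then have "(-1) ^ (d - i) = ((-1) ^ d * (-1) ^ i :: 'a ypoly)"
      by (auto simp: minus_one_power_iff)
    then show "(-1) ^ (d - i) * lift n a v (d - i) * Y i
        = (-1) ^ d * ((-1) ^ i * (xder n ^^ i) (lift n a v d) * Y i)"
      using \<open>i \<in> {..d}\<close> by (simp add: xderpow_lift assms mult.assoc)
  qed simp
  also have "\<dots> = (-1) ^ d * (\<Sum>i\<le>d. (-1) ^ i * (xder n ^^ i) (lift n a v d) * Y i)"
    by (simp add: sum_distrib_left)
  also have "(\<Sum>i\<le>d. (-1) ^ i * (xder n ^^ i) (lift n a v d) * Y i) = contract n (lift n a v d)"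
    unfolding contract_def
    by (rule sum.mono_neutral_left) (use assms(5) in \<open>auto simp: xderpow_lift[OF assms(1,2,4)]\<close>)
  finally show ?thesis .
qed

lemma minus_one_power_mult_eq_scale: "(-1) ^ d * p = scale ((-1) ^ d) p"
  by (cases "even d") (simp_all add: scale_def Const_def single_uminus)

lemma Z_comp_subspace: "ypoly.subspace (Z_comp n k :: 'a::field_char_0 ypoly set)"
  by (auto simp: Z_comp_eq ypoly.subspace_def Vhom_0 Vhom_add Vhom_scale
      derivation_0[OF derivation_xder] derivation_add[OF derivation_xder]
      derivation_scale[OF derivation_xder])

text \<open>Only the eigenvalue equation is claimed, since the outermost product may be zero. Each
  step changes the eigenvalue \<open>a\<close> to \<open>a - 2 * d + n\<close>.\<close>

lemma iterated_Z_comp: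
  fixes u :: "'a::field_char_0 ypoly"
  assumes "iterated n k u"
  shows "u \<in> Z_comp n k \<and> (\<exists>a. hhat n u = scale (of_int a) u)"
  using assms
proof (induction rule: iterated.induct)
  case base
  then show ?case
    using Vhom_Y[of 0 n] hhat_Y0[of n] unfolding Z_comp_eq by (blast intro: xder_Y[of n 0, simplified])
next
  case (step k u d)
  then obtain a where a: "u \<noteq> 0" "hhat n u = scale (of_int a) u"
    unfolding circ_defined_def circ_arg_def eigenvector_def by blast
  have u: "u \<in> Vhom n k" "xder n u = 0" using step.IH by (auto simp: Z_comp_eq)
  have d: "int d \<le> a" "d \<le> n"
    using step.hyps(2) by (auto simp: circ_defined_def eigenvalue_eq[OF a] eigenvalue_eq[OF Y_neq_0 hhat_Y0])
  interpret sl2: sl2_module "scale :: 'a \<Rightarrow> _" "xder n" "fhat n" "hhat n" "Vhom n k"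
    by (rule sl2_module_Vhom)
  obtain c where c: "lift n a u d = scale c ((fhat n ^^ d) u)"
    using lift_eq_scale_fhatpow[of d a n u] d by auto
  have "lift n a u d \<in> Vhom n k"
    unfolding c by (intro Vhom_scale sl2.Fpow_V u)
  moreover have "hhat n (lift n a u d) = scale (of_int (a - 2 * int d)) (lift n a u d)"
    unfolding c using sl2.weight_scale[OF sl2.weight_Fpow[of a u d]] a(2) by (simp only: sl2.weight_def)
  moreover have "(xder n ^^ Suc n) (lift n a u d) = 0"
    unfolding xderpow_lift[OF u(2) a(2) d(1)] using d by simp
  ultimately have "contract n (lift n a u d) \<in> Z_comp n (Suc k)"
    "hhat n (contract n (lift n a u d)) = scale (of_int (a - 2 * int d + int n)) (contract n (lift n a u d))"
    by (auto simp only: Z_comp_eq mem_Collect_eq intro!: contract_Vhom xder_contract hhat_contract)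
  then show ?case
    unfolding circ_Y0[OF u(2) a(2,1) d] minus_one_power_mult_eq_scale
    using ypoly.subspace_scale[OF Z_comp_subspace] sl2.weight_scale unfolding sl2.weight_def by blast
qed

section \<open>Weight decomposition and the spanning statement\<close>

lemma hhat_single:
  "\<exists>w. \<forall>m. hhat n (Poly_Mapping.single m (1 :: 'a::comm_ring_1)) = scale (of_int (w m)) (Poly_Mapping.single m 1)"
proof (rule choice, rule allI)
  fix m :: "nat \<Rightarrow>\<^sub>0 nat"
  show "\<exists>a. hhat n (Poly_Mapping.single m (1 :: 'a)) = scale (of_int a) (Poly_Mapping.single m 1)"
  proof (induction m rule: exponent_induct)
    case zero
    then show ?case
      by (intro exI[of _ 0]) (simp add: derivation_1[OF derivation_hhat] scale_def)
  next
    case (add m i)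
    have "hhat n (Y i :: 'a ypoly) = scale (of_int (if i \<le> n then int n - 2 * int i else 0)) (Y i)"
      by (simp only: hhat_Y scale_of_int)
    with add show ?case unfolding single_add_single using hhat_mult by blast
  qed
qed

text \<open>Monomials are weight vectors, so it suffices to group the terms of \<open>p\<close> by
  weight.\<close>

lemma weight_decomposition:
  fixes p :: "'a::field_char_0 ypoly"
  assumes "p \<in> Vhom n k"
  obtains B v where "finite B" "p = (\<Sum>b\<in>B. v b)"
    "\<And>b. b \<in> B \<Longrightarrow> v b \<in> Vhom n k \<and> hhat n (v b) = scale (of_int b) (v b)"
proof -
  obtain w where w: "\<And>m. hhat n (Poly_Mapping.single m (1 :: 'a)) = scale (of_int (w m)) (Poly_Mapping.single m 1)"
    using hhat_single by blast
  have w': "hhat n (Poly_Mapping.single m c) = scale (of_int (w m)) (Poly_Mapping.single m c)" for m and c :: 'a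
    by (subst (1 2) single_eq_scale) (simp add: derivation_scale[OF derivation_hhat] w mult.commute)
  let ?K = "Poly_Mapping.keys p"
  define v where "v b = (\<Sum>m\<in>{m\<in>?K. w m = b}. Poly_Mapping.single m (Poly_Mapping.lookup p m))" for b
  show ?thesis
  proof
    show "p = (\<Sum>b\<in>w ` ?K. v b)"
      unfolding v_def by (subst sum.image_gen[symmetric]) (simp_all add: sum_single_lookup)
    show "v b \<in> Vhom n k \<and> hhat n (v b) = scale (of_int b) (v b)" for b
    proof
      show "v b \<in> Vhom n k"
        unfolding v_def using assms by (intro Vhom_sum) (auto simp: in_Vhom_iff)
      show "hhat n (v b) = scale (of_int b) (v b)"
        by (simp add: v_def derivation_sum[OF derivation_hhat] w' ypoly.scale_sum_right)
    qed
  qed simp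
qed

theorem span_iterated:
  assumes "k \<ge> 1"
  shows "ypoly.span {u :: 'a::field_char_0 ypoly. iterated n k u} = Z_comp n k"
proof
  show "ypoly.span {u :: 'a ypoly. iterated n k u} \<subseteq> Z_comp n k"
    using iterated_Z_comp by (intro ypoly.span_minimal Z_comp_subspace) blast
  show "Z_comp n k \<subseteq> ypoly.span {u :: 'a ypoly. iterated n k u}"
    using assms
  proof (induction k rule: nat_induct_at_least)
    case base
    show ?case
    proof
      fix u :: "'a ypoly" assume "u \<in> Z_comp n 1"
      then have u: "u \<in> Vhom n (Suc 0)" "xder n u = 0" by (auto simp: Z_comp_eq)
      obtain c where c: "partial_deriv 0 u = Const c"
        using partial_deriv_Vhom[OF u(1)] by (rule Vhom_zero_degree)
      \<comment> \<open>In degree 1 the derivative is constant, so \<open>x\<close> kills it and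
        only the summand with \<open>Y 0\<close> remains in the contraction.\<close>
      have "(xder n ^^ i) (Const c) * Y i = 0" if "i \<noteq> 0" for i
        using that by (cases i) (simp_all add: funpow_swap1 derivation_Const[OF derivation_xder] xderpow_0)
      then have "contract n (Const c) = (\<Sum>i\<le>n. if i = 0 then Const c * Y 0 else 0)"
        unfolding contract_def by (intro sum.cong) (auto simp: mult.assoc)
      then have "u = scale c (Y 0)"
        using contract_partial_deriv[OF u] by (simp add: c scale_def)
      then show "u \<in> ypoly.span {u. iterated n 1 u}"
        by (simp only:) (intro ypoly.span_scale ypoly.span_base CollectI iterated.base)
    qed
  next
    case (Suc k)
    let ?S = "ypoly.span {u :: 'a ypoly. iterated n (Suc k) u}"
    interpret sl2: sl2_module "scale :: 'a \<Rightarrow> _" "xder n" "fhat n" "hhat n" "Vhom n k"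
      by (rule sl2_module_Vhom)
    have fhat_iterated: "contract n ((fhat n ^^ j) w) \<in> ?S" if j: "j \<le> n" and iter: "iterated n k w" for j w
    proof (cases "w = 0")
      case True
      have "(fhat n ^^ j) 0 = (0 :: 'a ypoly)"
        by (induction j) (simp_all add: derivation_0[OF derivation_fhat])
      then show ?thesis by (simp add: True contract_0 ypoly.span_zero)
    next
      case False
      obtain a where w: "w \<in> Z_comp n k" "hhat n w = scale (of_int a) w"
        using iterated_Z_comp iter by blast
      then have x: "xder n w = 0" by (simp add: Z_comp_eq)
      show ?thesis
      \<comment> \<open>If \<open>j\<close> is at most the eigenvalue, the product with
        \<open>Y 0\<close> is defined and is a nonzero multiple of the contraction. Otherwise it is
        not defined, but \<open>(fhat n ^^ j) w\<close> is already zero.\<close>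
      proof (cases "int j \<le> a")
        case True
        have "circ_arg n w"
          using w False unfolding circ_arg_def eigenvector_def Z_comp_def by blast
        moreover have "circ_arg n (Y 0 :: 'a ypoly)"
          using iterated_Z_comp[OF iterated.base[of n]] Y_neq_0 hhat_Y0
          unfolding circ_arg_def eigenvector_def Z_comp_def by blast
        ultimately have "circ_defined n j w (Y 0)"
          using True j
          by (simp add: circ_defined_def eigenvalue_eq[OF False w(2)] eigenvalue_eq[OF Y_neq_0 hhat_Y0])
        then have circ: "circ n j w (Y 0) \<in> ?S"
          using iterated.step iter by (intro ypoly.span_base) blast
        obtain c where c: "c \<noteq> 0" "lift n a w j = scale c ((fhat n ^^ j) w)"
          using lift_eq_scale_fhatpow True by blast
        \<comment> \<open>The factor undoes the sign in \<open>circ_Y0\<close> and the normalisation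
          of \<open>lift\<close>.\<close>
        have "scale ((-1) ^ j / c) (circ n j w (Y 0)) = contract n ((fhat n ^^ j) w)"
          unfolding circ_Y0[OF x w(2) False True j] minus_one_power_mult_eq_scale c(2) contract_scale
          using c(1) by (simp flip: power_mult_distrib)
        then show ?thesis using ypoly.span_scale[OF circ] by metis
      next
        case F: False
        then have "(fhat n ^^ j) w = 0"
          using sl2.Fpow_highest_weight_eq_0[OF x, of a j] w(2) by (simp add: sl2.weight_def)
        then show ?thesis by (simp add: contract_0 ypoly.span_zero)
      qed
    qed
    have fhatpow: "(fhat n ^^ j) (p + q) = (fhat n ^^ j) p + (fhat n ^^ j) q"
       "(fhat n ^^ j) (scale c p) = scale c ((fhat n ^^ j) p)" "(fhat n ^^ j) 0 = (0 :: 'a ypoly)"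
      for j c and p q :: "'a ypoly"
      by (induction j) (auto simp: derivation_add[OF derivation_fhat]
          derivation_scale[OF derivation_fhat] derivation_0[OF derivation_fhat])
    have fhat_Z: "contract n ((fhat n ^^ j) w) \<in> ?S" if "j \<le> n" "w \<in> Z_comp n k" for j w
    proof -
      \<comment> \<open>The set on the right is a subspace, so the induction hypothesis extends the
        claim from iterated products to all of \<open>Z_comp n k\<close>.\<close>
      have "ypoly.span {u. iterated n k u} \<subseteq> {w. contract n ((fhat n ^^ j) w) \<in> ?S}"
        using fhat_iterated that(1)
        by (intro ypoly.span_minimal)
          (auto simp: ypoly.subspace_def fhatpow contract_0 contract_add contract_scale
            intro: ypoly.span_zero ypoly.span_add ypoly.span_scale)
      then show ?thesis using Suc.IH that(2) by blast
    qed
    show ?case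
    proof
      fix u :: "'a ypoly" assume "u \<in> Z_comp n (Suc k)"
      then have u: "u \<in> Vhom n (Suc k)" "xder n u = 0" by (auto simp: Z_comp_eq)
      obtain B v where v: "finite B" "partial_deriv 0 u = (\<Sum>b\<in>B. v b)"
        "\<And>b. b \<in> B \<Longrightarrow> v b \<in> Vhom n k \<and> hhat n (v b) = scale (of_int b) (v b)"
        by (rule weight_decomposition[OF partial_deriv_Vhom[OF u(1), of 0]]) blast
      \<comment> \<open>Because \<open>x ^^ Suc n\<close> kills the derivative, only exponents j
        \<le> n occur. This matches the bound \<open>n\<close>, the eigenvalue of
        \<open>Y 0\<close>, in \<open>circ_defined\<close>.\<close>
      have "partial_deriv 0 u \<in> ypoly.span {(fhat n ^^ j) w | j w. j < Suc n \<and> w \<in> Vhom n k \<and> xder n w = 0}"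
        unfolding v(2)
        by (rule sl2.in_span_Fpow_if_Xpow_eq_0)
          (use v xderpow_partial_deriv_eq_0[OF u(2)] in \<open>auto simp: sl2.weight_def simp del: funpow.simps\<close>)
      moreover have "ypoly.span {(fhat n ^^ j) w | j w. j < Suc n \<and> w \<in> Vhom n k \<and> xder n w = 0}
          \<subseteq> {p. contract n p \<in> ?S}"
        using fhat_Z
        by (intro ypoly.span_minimal)
          (auto simp: Z_comp_eq ypoly.subspace_def contract_0 contract_add contract_scale
            intro: ypoly.span_zero ypoly.span_add ypoly.span_scale)
      ultimately have "scale (of_nat (Suc k)) u \<in> ?S"
        using contract_partial_deriv[OF u] by (auto simp: scale_of_nat simp del: of_nat_Suc)
      from ypoly.span_scale[OF this, of "1 / of_nat (Suc k)"] show "u \<in> ?S"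
        by (simp del: of_nat_Suc)
    qed
  qed
qed

section \<open>Minimal generating sets\<close>

definition hcomp :: "nat \<Rightarrow> 'a::comm_monoid_add ypoly \<Rightarrow> 'a ypoly" where
  "hcomp k p = (\<Sum>m\<in>{m \<in> Poly_Mapping.keys p. deg m = k}.
    Poly_Mapping.single m (Poly_Mapping.lookup p m))"

lemma lookup_hcomp:
  "Poly_Mapping.lookup (hcomp k p) m = (if deg m = k then Poly_Mapping.lookup p m else 0)"
  by (cases "m \<in> Poly_Mapping.keys p")
    (auto simp: hcomp_def lookup_sum lookup_single when_def in_keys_iff)

lemma hcomp_0: "hcomp k 0 = 0"
  by (simp add: hcomp_def)

lemma hcomp_add: "hcomp k (p + q) = hcomp k p + hcomp k q"
  by (rule poly_mapping_eqI) (simp add: lookup_hcomp lookup_add)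

lemma hcomp_sum: "hcomp k (\<Sum>i\<in>A. f i) = (\<Sum>i\<in>A. hcomp k (f i))"
  by (induction A rule: infinite_finite_induct) (simp_all add: hcomp_0 hcomp_add)

lemma hcomp_Vhom: "p \<in> polys n \<Longrightarrow> hcomp k p \<in> Vhom n k"
  by (auto simp: in_Vhom_iff polys_def in_keys_iff lookup_hcomp split: if_splits)

lemma hcomp_of_Vhom: "p \<in> Vhom n j \<Longrightarrow> hcomp k p = (if j = k then p else 0)"
  by (rule poly_mapping_eqI) (auto simp: lookup_hcomp in_Vhom_iff in_keys_iff)

lemma sum_hcomp: "(\<Sum>k\<in>deg ` Poly_Mapping.keys p. hcomp k p) = p"
  unfolding hcomp_def by (subst sum.image_gen[symmetric]) (simp_all add: sum_single_lookup)

lemma Vhom_subset_polys: "Vhom n k \<subseteq> polys n"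
  by (auto simp: Vhom_def)

text \<open>\<open>x\<close> preserves the degree of each homogeneous component. Consequently the
  components of an element of \<open>Z n\<close> lie in \<open>Z n\<close> again.\<close>

lemma xder_hcomp:
  assumes "p \<in> polys n"
  shows "xder n (hcomp k p) = hcomp k (xder n p)"
proof -
  let ?K = "deg ` Poly_Mapping.keys p"
  have "hcomp k (xder n p) = (\<Sum>j\<in>?K. hcomp k (xder n (hcomp j p)))"
    by (simp only: sum_hcomp flip: hcomp_sum derivation_sum[OF derivation_xder])
  also have "\<dots> = (\<Sum>j\<in>?K. xder n (hcomp k (hcomp j p)))"
    by (intro sum.cong) (simp_all add: hcomp_of_Vhom[OF hcomp_Vhom[OF assms]]
        hcomp_of_Vhom[OF xder_Vhom[OF hcomp_Vhom[OF assms]]] derivation_0[OF derivation_xder])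
  also have "\<dots> = xder n (hcomp k p)"
    by (simp only: sum_hcomp flip: hcomp_sum derivation_sum[OF derivation_xder])
  finally show ?thesis by simp
qed

lemma hcomp_Z: "p \<in> Z n \<Longrightarrow> hcomp k p \<in> Z_comp n k"
  by (auto simp: Z_comp_eq Z_def hcomp_Vhom xder_hcomp hcomp_0)

lemma Z_comp_subset_Z: "Z_comp n k \<subseteq> Z n"
  by (auto simp: Z_comp_def)

lemma Const_in_Z: "Const c \<in> Z n"
  using Vhom_Const[of c n] Vhom_subset_polys
  by (auto simp: Z_def derivation_Const[OF derivation_xder])

lemma subalgebra_Z: "subalgebra (Z n :: 'a::comm_ring_1 ypoly set)"
proof -
  have "p + q \<in> polys n" if "p \<in> polys n" "q \<in> polys n" for p q :: "'a ypoly"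
    using that keys_add[of p q] by (force simp: polys_def)
  moreover have "p * q \<in> polys n" if "p \<in> polys n" "q \<in> polys n" for p q :: "'a ypoly"
    using that keys_mult[of p q] by (fastforce simp: polys_def keys_add_nat)
  ultimately show ?thesis
    using Const_in_Z[where 'a = 'a and n = n]
    by (auto simp: subalgebra_def Z_def derivation_add[OF derivation_xder]
        derivation_mult[OF derivation_xder])
qed

section \<open>Subalgebras and decomposable elements\<close>

lemma subalgebra_hull: "subalgebra (subalgebra hull S)"
  by (rule hull_in) (auto simp: subalgebra_def)

lemma subspace_if_subalgebra:
  fixes A :: "'a::field ypoly set"
  assumes "subalgebra A"
  shows "ypoly.subspace A"
  using assms Const_0 by (auto simp: subalgebra_def ypoly.subspace_def scale_def image_subset_iff)
    (metis Const_0)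

text \<open>The span is the degree \<open>k\<close> part of the square of the ideal of elements
  without constant term in \<open>Z n\<close>. New generators in degree \<open>k\<close> are counted
  modulo this span.\<close>

definition decomposables :: "nat \<Rightarrow> nat \<Rightarrow> 'a::comm_ring_1 ypoly set" where
  "decomposables n k =
    {p * q | p q i j. 0 < i \<and> 0 < j \<and> i + j = k \<and> p \<in> Z_comp n i \<and> q \<in> Z_comp n j}"

lemma decomposables_subset: "decomposables n k \<subseteq> Z_comp n k"
  by (auto simp: decomposables_def Z_comp_eq Vhom_mult derivation_mult[OF derivation_xder])

text \<open>Extend a basis \<open>B\<close> of \<open>span W\<close> by elements of \<open>T\<close>
  to a basis \<open>C\<close> of the span of both sets; the added vectors \<open>C - B\<close> serve
  as \<open>S\<close>. A relation violating irredundancy would put some \<open>s\<close> into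
  \<open>span (C - {s})\<close>.\<close>

lemma (in vector_space) exists_irredundant_complement:
  obtains S where "S \<subseteq> T" "span (W \<union> S) = span (W \<union> T)"
    "\<And>s. s \<in> S \<Longrightarrow> s \<notin> span (W \<union> (S - {s}))"
proof -
  obtain B where B: "B \<subseteq> W" "independent B" "W \<subseteq> span B"
    using maximal_independent_subset[of W] by blast
  obtain C where C: "B \<subseteq> C" "C \<subseteq> B \<union> T" "independent C" "B \<union> T \<subseteq> span C"
    using maximal_independent_subset_extend[of B "B \<union> T"] B(2) by blast
  show ?thesis
  proof
    show "C - B \<subseteq> T" using C by blast
    have "W \<union> T \<subseteq> span C"
      using B(3) C(4) span_mono[OF C(1)] by blast
    moreover have "C \<subseteq> W \<union> (C - B)" using B(1) by blast
    ultimately have "span (W \<union> T) \<subseteq> span (W \<union> (C - B))"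
      by (meson span_minimal span_mono subspace_span order_trans)
    moreover have "span (W \<union> (C - B)) \<subseteq> span (W \<union> T)"
      using C(2) by (intro span_mono) blast
    ultimately show "span (W \<union> (C - B)) = span (W \<union> T)" by blast
    fix s assume s: "s \<in> C - B"
    then have "B \<subseteq> C - {s}" using C(1) by blast
    then have "W \<union> (C - B - {s}) \<subseteq> span (C - {s})"
      using B(3) span_mono[of B "C - {s}"] span_superset[of "C - {s}"] by blast
    then have "span (W \<union> (C - B - {s})) \<subseteq> span (C - {s})"
      by (intro span_minimal subspace_span)
    moreover have "s \<notin> span (C - {s})"
      using C(3) s unfolding dependent_def by blast
    ultimately show "s \<notin> span (W \<union> (C - B - {s}))" by blast
  qed
qed

lemma Z_comp_0: "p \<in> Z_comp n 0 \<Longrightarrow> \<exists>c. p = Const c"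
  unfolding Z_comp_eq by (blast elim: Vhom_zero_degree)

text \<open>Strong induction on the degree: degree 0 consists of constants, and the factors of a
  decomposable element have smaller degree. Arbitrary elements are sums of their homogeneous
  components.\<close>

lemma generates_Z:
  fixes S :: "nat \<Rightarrow> 'a::field_char_0 ypoly set"
  assumes "\<And>k. 0 < k \<Longrightarrow> ypoly.span (decomposables n k \<union> S k) = Z_comp n k"
  shows "generates (\<Union>k\<in>{0<..}. S k) (Z n)"
proof -
  let ?A = "subalgebra hull (\<Union>k\<in>{0<..}. S k)"
  have A: "range Const \<subseteq> ?A" "\<And>p q. p \<in> ?A \<Longrightarrow> q \<in> ?A \<Longrightarrow> p * q \<in> ?A"
    using subalgebra_hull[of "\<Union>k\<in>{0<..}. S k"] by (auto simp: subalgebra_def)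
  have subspace: "ypoly.subspace ?A"
    by (intro subspace_if_subalgebra subalgebra_hull)
  have "Z_comp n k \<subseteq> ?A" for k
  proof (induction k rule: less_induct)
    case (less k)
    show ?case
    proof (cases "k = 0")
      case True
      then show ?thesis using Z_comp_0 A(1) by blast
    next
      case False
      have "decomposables n k \<subseteq> ?A"
      proof
        fix u :: "'a ypoly" assume "u \<in> decomposables n k"
        then obtain p q i j where "u = p * q" "0 < i" "0 < j" "i + j = k"
          "p \<in> Z_comp n i" "q \<in> Z_comp n j"
          by (auto simp: decomposables_def)
        moreover from this have "i < k" "j < k" by auto
        ultimately show "u \<in> ?A" using less.IH A(2) by blast
      qed
      moreover have "S k \<subseteq> ?A"
        using hull_subset[of "\<Union>k\<in>{0<..}. S k" subalgebra] False by auto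
      ultimately have "ypoly.span (decomposables n k \<union> S k) \<subseteq> ?A"
        using subspace by (intro ypoly.span_minimal) auto
      then show ?thesis using assms False by simp
    qed
  qed
  have "Z n \<subseteq> ?A"
  proof
    fix p :: "'a ypoly" assume "p \<in> Z n"
    then have "hcomp k p \<in> ?A" for k
      using hcomp_Z \<open>\<And>k. Z_comp n k \<subseteq> ?A\<close> by blast
    then have "(\<Sum>k\<in>deg ` Poly_Mapping.keys p. hcomp k p) \<in> ?A"
      by (intro ypoly.subspace_sum[OF subspace])
    then show "p \<in> ?A" by (simp only: sum_hcomp)
  qed
  moreover have "?A \<subseteq> Z n"
  proof (rule hull_minimal[where S = subalgebra, OF _ subalgebra_Z], rule UN_least)
    fix k :: nat assume "k \<in> {0<..}"
    then have "S k \<subseteq> Z_comp n k"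
      using assms[of k] ypoly.span_superset[of "decomposables n k \<union> S k"] by auto
    then show "S k \<subseteq> Z n" using Z_comp_subset_Z by blast
  qed
  ultimately show ?thesis by (simp add: generates_def)
qed

lemma not_generates_Z:
  fixes S :: "nat \<Rightarrow> 'a::field_char_0 ypoly set"
  assumes S: "\<And>k. 0 < k \<Longrightarrow> S k \<subseteq> Z_comp n k"
    and irredundant: "\<And>k s. 0 < k \<Longrightarrow> s \<in> S k \<Longrightarrow>
      s \<notin> ypoly.span (decomposables n k \<union> (S k - {s}))"
    and T: "T \<subset> (\<Union>k\<in>{0<..}. S k)"
  shows "\<not> generates T (Z n)"
proof
  assume gen: "generates T (Z n)"
  obtain s k where s: "0 < k" "s \<in> S k" "s \<notin> T" using T by blast
  define E where "E = ypoly.span (decomposables n k \<union> (S k - {s}))"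
  have E: "ypoly.subspace E" by (simp add: E_def)
  \<comment> \<open>With \<open>s\<close> a generator missing from \<open>T\<close>, the aim is that
    \<open>M\<close> is a subalgebra containing \<open>T\<close> but not \<open>s\<close>, so that
    \<open>T\<close> cannot generate \<open>Z n\<close>.\<close>
  define M where "M = {p \<in> Z n. hcomp k p \<in> E}"
  have "subalgebra M"
    unfolding subalgebra_def
  proof (intro conjI ballI subsetI)
    fix u :: "'a ypoly" assume "u \<in> range Const"
    then obtain c where u: "u = Const c" by blast
    have "hcomp k u = 0"
      using s(1) by (simp add: u hcomp_of_Vhom[OF Vhom_Const])
    then show "u \<in> M"
      using ypoly.subspace_0[OF E] Const_in_Z by (auto simp: M_def u)
  next
    fix p q assume "p \<in> M" "q \<in> M"
    then show "p + q \<in> M"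
      using subalgebra_Z[of n] ypoly.subspace_add[OF E] by (auto simp: M_def subalgebra_def hcomp_add)
  next
    fix p q assume pq: "p \<in> M" "q \<in> M"
    have comp: "hcomp i p \<in> Z_comp n i" "hcomp i q \<in> Z_comp n i" for i
      using pq by (auto simp: M_def hcomp_Z)
    \<comment> \<open>If one factor has degree 0, it is a scalar and the product is a multiple of
      the degree \<open>k\<close> component of the other element, which lies in \<open>E\<close>. If
      both degrees are positive and add up to \<open>k\<close>, the product is decomposable.\<close>
    have "hcomp k (hcomp i p * hcomp j q) \<in> E" for i j
    proof (cases "i + j = k")
      case False
      have "hcomp i p * hcomp j q \<in> Vhom n (i + j)"
        using comp by (intro Vhom_mult) (auto simp: Z_comp_eq)
      then show ?thesis
        using False ypoly.subspace_0[OF E] by (simp add: hcomp_of_Vhom)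
    next
      case True
      have "hcomp i p * hcomp j q \<in> Vhom n k"
        using comp unfolding True[symmetric] by (intro Vhom_mult) (auto simp: Z_comp_eq)
      then have eq: "hcomp k (hcomp i p * hcomp j q) = hcomp i p * hcomp j q"
        by (simp add: hcomp_of_Vhom)
      consider "i = 0" | "j = 0" | "0 < i" "0 < j" by blast
      then show ?thesis
      proof cases
        case 1
        then obtain c where "hcomp i p = Const c" using comp(1) Z_comp_0 by blast
        then show ?thesis
          using 1 True pq ypoly.subspace_scale[OF E, of "hcomp k q" c]
          unfolding eq by (simp add: M_def scale_def)
      next
        case 2
        then obtain c where "hcomp j q = Const c" using comp(2) Z_comp_0 by blast
        then show ?thesis
          using 2 True pq ypoly.subspace_scale[OF E, of "hcomp k p" c]
          unfolding eq by (simp add: M_def scale_def mult.commute)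
      next
        case 3
        then have "hcomp i p * hcomp j q \<in> decomposables n k"
          using comp True unfolding decomposables_def by blast
        then show ?thesis unfolding eq E_def by (intro ypoly.span_base) simp
      qed
    qed
    then have "(\<Sum>i\<in>deg ` Poly_Mapping.keys p. \<Sum>j\<in>deg ` Poly_Mapping.keys q.
        hcomp k (hcomp i p * hcomp j q)) \<in> E"
      by (intro ypoly.subspace_sum[OF E])
    moreover have "(\<Sum>i\<in>deg ` Poly_Mapping.keys p. \<Sum>j\<in>deg ` Poly_Mapping.keys q.
        hcomp k (hcomp i p * hcomp j q)) = hcomp k (p * q)"
      by (simp only: sum_hcomp flip: hcomp_sum sum_product)
    ultimately show "p * q \<in> M"
      using pq subalgebra_Z[of n] by (auto simp: M_def subalgebra_def)
  qed
  moreover have "T \<subseteq> M"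
  proof
    fix t assume t: "t \<in> T"
    then obtain j where j: "0 < j" "t \<in> S j" using T by auto
    then have tZ: "t \<in> Z_comp n j" using S by blast
    then have hcomp_t: "hcomp k t = (if j = k then t else 0)"
      by (intro hcomp_of_Vhom[of _ n]) (simp add: Z_comp_eq)
    have "hcomp k t \<in> E"
    proof (cases "j = k")
      case True
      \<comment> \<open>Here \<open>t\<close> differs from \<open>s\<close> because \<open>s\<close>
        is not in \<open>T\<close>.\<close>
      then have "t \<in> E"
        using t s j unfolding E_def by (intro ypoly.span_base) auto
      then show ?thesis using True by (simp add: hcomp_t)
    next
      case False
      then show ?thesis
        using ypoly.subspace_0[OF E] by (simp add: hcomp_t)
    qed
    then show "t \<in> M" using tZ Z_comp_subset_Z by (auto simp: M_def)
  qed
  ultimately have "Z n \<subseteq> M"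
    using gen hull_minimal[of T M subalgebra] by (simp add: generates_def)
  moreover have sZ: "s \<in> Z_comp n k" using S s by blast
  ultimately have "hcomp k s \<in> E" using Z_comp_subset_Z by (auto simp: M_def)
  moreover have "hcomp k s = s"
    using sZ hcomp_of_Vhom[of s n k k] by (simp add: Z_comp_eq)
  ultimately have "s \<in> E" by simp
  then show False using irredundant s by (simp add: E_def)
qed

theorem corollary5p2:
  fixes n :: nat
  assumes "n \<ge> 1"
  shows "(\<forall>k\<ge>1. ypoly.span {u :: 'a::field_char_0 ypoly. iterated n k u} = Z_comp n k)
    \<and> (\<exists>S :: 'a ypoly set. S \<subseteq> {u. \<exists>k\<ge>1. iterated n k u} \<and> minimal_generating_set S (Z n))"
proof (intro conjI allI impI)
  show "ypoly.span {u :: 'a ypoly. iterated n k u} = Z_comp n k" if "k \<ge> 1" for k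
    using that by (rule span_iterated)
  \<comment> \<open>In each degree separately, pick iterated products that are irredundant modulo
    decomposables; the generating set is their union over positive degrees.\<close>
  have "\<exists>S \<subseteq> {u :: 'a ypoly. iterated n k u}.
      ypoly.span (decomposables n k \<union> S) = ypoly.span (decomposables n k \<union> {u. iterated n k u})
      \<and> (\<forall>s\<in>S. s \<notin> ypoly.span (decomposables n k \<union> (S - {s})))" for k
    by (rule ypoly.exists_irredundant_complement[of "{u. iterated n k u}" "decomposables n k"]) blast
  then obtain S :: "nat \<Rightarrow> 'a ypoly set" where S: "\<And>k. S k \<subseteq> {u. iterated n k u}"
    "\<And>k. ypoly.span (decomposables n k \<union> S k)
      = ypoly.span (decomposables n k \<union> {u. iterated n k u})"
    "\<And>k s. s \<in> S k \<Longrightarrow> s \<notin> ypoly.span (decomposables n k \<union> (S k - {s}))"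
    by metis
  \<comment> \<open>The iterated products alone already span \<open>Z_comp n k\<close>, and the
    decomposables lie inside it.\<close>
  have span: "ypoly.span (decomposables n k \<union> S k) = Z_comp n k" if "0 < k" for k
  proof -
    have "ypoly.span {u :: 'a ypoly. iterated n k u} = Z_comp n k"
      using that by (intro span_iterated) simp
    then show ?thesis
      unfolding S(2) using decomposables_subset[of n k]
      by (intro subset_antisym ypoly.span_minimal Z_comp_subspace)
        (auto intro: ypoly.span_base subsetD[OF ypoly.span_mono])
  qed
  show "\<exists>S :: 'a ypoly set. S \<subseteq> {u. \<exists>k\<ge>1. iterated n k u} \<and> minimal_generating_set S (Z n)"
  proof (intro exI conjI)
    show "(\<Union>k\<in>{0<..}. S k) \<subseteq> {u. \<exists>k\<ge>1. iterated n k u}"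
      using S(1) by (auto simp: Suc_le_eq)
    have "S k \<subseteq> Z_comp n k" for k
      using S(1) iterated_Z_comp by blast
    then show "minimal_generating_set (\<Union>k\<in>{0<..}. S k) (Z n)"
      unfolding minimal_generating_set_def
      using generates_Z[of n S] span not_generates_Z[of S n] S(3) by blast
  qed
qed

end
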